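(* Let $\mathfrak H,\mathfrak M,\mathfrak N$ be separable Hilbert spaces. (1) Let $\tau=\left\{\begin{pmatrix}A&B\\ C&D\end{pmatrix};\mathfrak H,\mathfrak M,\mathfrak N\right\}$ be a passive system and let $$T=\begin{pmatrix}A&B\\ C&D\end{pmatrix}=\begin{pmatrix}-FD^*G+D_{F^*}LD_G&FD_D\\ D_{D^*}G&D\end{pmatrix}:\mathfrak H\oplus\mathfrak M\to\mathfrak H\oplus\mathfrak N$$ with contractions $F\in\mathbf L(\mathfrak D_D,\mathfrak H)$, $G\in\mathbf L(\mathfrak H,\mathfrak D_{D^*})$, $L\in\mathbf L(\mathfrak D_G,\mathfrak D_{F^*})$. Let $\Theta(\lambda)$ be the transfer function of $\tau$. Then: (i) the Möbius parameter $Z(\lambda)$ of $\Theta(\lambda)$ is the transfer function of the passive system $\nu=\left\{\begin{pmatrix}D_{F^*}LD_G&F\\ G&0\end{pmatrix};\mathfrak H,\mathfrak D_D,\mathfrak D_{D^*}\right\}$; (ii) if $\tau$ is isometric (co-isometric), then $\nu$ is isometric (co-isometric); (iii) $\mathfrak H^c_\nu=\mathfrak H^c_\tau$ and $\mathfrak H^o_\nu=\mathfrak H^o_\tau$, and hence if $\tau$ is controllable (observable) then $\nu$ is controllable (observable), and if $\tau$ is simple (minimal) then $\nu$ is simple (minimal). (2) Let a nonconstant function $\Theta(\lambda)$ belong to the Schur class $\mathbf S(\mathfrak M,\mathfrak N)$ and let $Z(\lambda)$ be its Möbius parameter. Suppose that the transfer function of the linear system $\nu'=\left\{\begin{pmatrix}S&F\\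 G&0\end{pmatrix};\mathfrak H,\mathfrak D_{\Theta(0)},\mathfrak D_{\Theta^*(0)}\right\}$ coincides with $Z(\lambda)$ in a neighborhood of the origin. Then the transfer function of the linear system $$\tau'=\left\{\begin{pmatrix}-F\Theta^*(0)G+S&FD_{\Theta(0)}\\ D_{\Theta^*(0)}G&\Theta(0)\end{pmatrix};\mathfrak H,\mathfrak M,\mathfrak N\right\}$$ coincides with $\Theta(\lambda)$ in a neighborhood of the origin. Moreover: (a) $\mathfrak H^c_{\tau'}=\mathfrak H^c_{\nu'}$ and $\mathfrak H^o_{\tau'}=\mathfrak H^o_{\nu'}$, and hence if $\nu'$ is controllable (observable) then $\tau'$ is controllable (observable), and if $\nu'$ is simple (minimal) then $\tau'$ is simple (minimal); (b) if $\nu'$ is passive then $\tau'$ is passive; (c) if $\nu'$ is isometric (co-isometric) then $\tau'$ is isometric (co-isometric).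
   Context: Hilbert spaces are complex; $\mathbf L(\mathfrak H_1,\mathfrak H_2)$ denotes bounded linear operators; $\mathbb D$ is the open unit disk. For a contraction $T$, $D_T=(I-T^*T)^{1/2}$ and $\mathfrak D_T=\overline{\mathrm{ran}}\,D_T$. Systems: a linear system $\tau=\left\{\begin{pmatrix}A&B\\ C&D\end{pmatrix};\mathfrak H,\mathfrak M,\mathfrak N\right\}$ consists of bounded operators $A:\mathfrak H\to\mathfrak H$, $B:\mathfrak M\to\mathfrak H$, $C:\mathfrak H\to\mathfrak N$, $D:\mathfrak M\to\mathfrak N$, with block operator $T_\tau=\begin{pmatrix}A&B\\ C&D\end{pmatrix}:\mathfrak H\oplus\mathfrak M\to\mathfrak H\oplus\mathfrak N$. It is passive (isometric, co-isometric) if $T_\tau$ is contractive (isometric, co-isometric). Its transfer function is $\Theta_\tau(\lambda)=D+\lambda C(I_{\mathfrak H}-\lambda A)^{-1}B$ (for $\lambda\in\mathbb D$ if the system is passive; near $0$ in general). $\mathfrak H^c_\tau=\overline{\mathrm{span}}\{A^nB\mathfrak M: n\ge0\}$, $\mathfrak H^o_\tau=\overline{\mathrm{span}}\{A^{*n}C^*\mathfrak N:n\ge0\}$. The system is controllable if $\mathfrak H^c_\tau=\mathfrak H$, observable if $\mathfrak H^o_\tau=\mathfrak H$, minimal if both, simple if $\mathfrak H$ is the closure of $\mathfrak H^c_\tau+\mathfrak H^o_\tau$. Schur class $\mathbf S(\mathfrak M,\mathfrak N)$: holomorphic functions on $\mathbb D$ whose values are contractions in $\mathbf L(\mathfrak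 M,\mathfrak N)$; transfer functions of passive systems belong to it. $\Theta^*(0)$ means $\Theta(0)^*$. Parametrization (known): $T=\begin{pmatrix}A&B\\ C&D\end{pmatrix}$ is a contraction iff $D$ is a contraction and $B=FD_D$, $C=D_{D^*}G$, $A=-FD^*G+D_{F^*}LD_G$ with uniquely determined contractions $F,G,L$ as in the claim. Möbius parameter (known): for $\Theta\in\mathbf S(\mathfrak M,\mathfrak N)$ there is a unique $Z\in\mathbf S(\mathfrak D_{\Theta(0)},\mathfrak D_{\Theta^*(0)})$ with $\Theta(\lambda)=\Theta(0)+D_{\Theta^*(0)}Z(\lambda)(I_{\mathfrak D_{\Theta(0)}}+\Theta^*(0)Z(\lambda))^{-1}D_{\Theta(0)}$ for all $\lambda\in\mathbb D$; $Z$ is called the Möbius parameter of $\Theta$. *)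

theory Defs
  imports "HOL-Analysis.Analysis"
begin

section \<open>Complex Hilbert spaces\<close>

text \<open>The underlying real Hilbert space carries the real part of the complex inner product;
  its norm is therefore the norm of the complex inner product.  The inner product is linear in
  its first argument.\<close>

class chilbert = real_inner + banach +
  fixes scaleC :: "complex \<Rightarrow> 'a \<Rightarrow> 'a" (infixr \<open>*\<^sub>C\<close> 75)
    and cinner :: "'a \<Rightarrow> 'a \<Rightarrow> complex"
  assumes scaleC_add_right: "c *\<^sub>C (x + y) = c *\<^sub>C x + c *\<^sub>C y"
    and scaleC_add_left: "(c + d) *\<^sub>C x = c *\<^sub>C x + d *\<^sub>C x"
    and scaleC_scaleC: "c *\<^sub>C d *\<^sub>C x = (c * d) *\<^sub>C x"
    and scaleC_of_real: "complex_of_real r *\<^sub>C x = r *\<^sub>R x"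
    and cinner_commute: "cinner x y = cnj (cinner y x)"
    and cinner_add_left: "cinner (x + y) z = cinner x z + cinner y z"
    and cinner_scaleC_left: "cinner (c *\<^sub>C x) y = c * cinner x y"
    and Re_cinner: "Re (cinner x y) = inner x y"

text \<open>The product type, with its library norm, is the orthogonal sum.\<close>

instantiation prod :: (chilbert, chilbert) chilbert
begin

definition scaleC_prod :: "complex \<Rightarrow> 'a \<times> 'b \<Rightarrow> 'a \<times> 'b"
  where "c *\<^sub>C p = (c *\<^sub>C fst p, c *\<^sub>C snd p)"

definition cinner_prod :: "'a \<times> 'b \<Rightarrow> 'a \<times> 'b \<Rightarrow> complex"
  where "cinner p q = cinner (fst p) (fst q) + cinner (snd p) (snd q)"

instance
proof
  fix c d :: complex and r :: real and x y z :: "'a \<times> 'b"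
  show "c *\<^sub>C (x + y) = c *\<^sub>C x + c *\<^sub>C y" "(c + d) *\<^sub>C x = c *\<^sub>C x + d *\<^sub>C x"
    "c *\<^sub>C d *\<^sub>C x = (c * d) *\<^sub>C x" "complex_of_real r *\<^sub>C x = r *\<^sub>R x"
    by (simp_all add: scaleC_prod_def prod_eq_iff scaleC_add_right scaleC_add_left
        scaleC_scaleC scaleC_of_real)
  show "cinner x y = cnj (cinner y x)"
    by (simp add: cinner_prod_def flip: cinner_commute)
  show "cinner (x + y) z = cinner x z + cinner y z" "cinner (c *\<^sub>C x) y = c * cinner x y"
    "Re (cinner x y) = inner x y"
    by (simp_all add: cinner_prod_def scaleC_prod_def inner_prod_def cinner_add_left
        cinner_scaleC_left Re_cinner algebra_simps)
qed

end

definition csubspace :: "'a::chilbert set \<Rightarrow> bool"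
  where "csubspace X \<longleftrightarrow> 0 \<in> X \<and> (\<forall>x\<in>X. \<forall>y\<in>X. x + y \<in> X) \<and> (\<forall>c. \<forall>x\<in>X. c *\<^sub>C x \<in> X)"

text \<open>A Hilbert space is given by its carrier, a closed subspace of a type of class
  \<open>chilbert\<close> (such as \<open>UNIV\<close>), so that defect spaces are Hilbert spaces in their own right.\<close>

definition hilbert :: "'a::chilbert set \<Rightarrow> bool"
  where "hilbert X \<longleftrightarrow> csubspace X \<and> closed X"


section \<open>Bounded operators\<close>

text \<open>An element of \<open>bop X Y\<close> is an operator from \<open>X\<close> to \<open>Y\<close>;
  its values outside \<open>X\<close> carry no meaning.\<close>

definition bop :: "'a::chilbert set \<Rightarrow> 'b::chilbert set \<Rightarrow> ('a \<Rightarrow> 'b) set"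
  where "bop X Y = {T. (\<forall>x\<in>X. T x \<in> Y) \<and>
    (\<forall>x\<in>X. \<forall>y\<in>X. T (x + y) = T x + T y) \<and>
    (\<forall>c. \<forall>x\<in>X. T (c *\<^sub>C x) = c *\<^sub>C T x) \<and>
    (\<exists>K. \<forall>x\<in>X. norm (T x) \<le> K * norm x)}"

definition contraction :: "'a::chilbert set \<Rightarrow> 'b::chilbert set \<Rightarrow> ('a \<Rightarrow> 'b) \<Rightarrow> bool"
  where "contraction X Y T \<longleftrightarrow> T \<in> bop X Y \<and> (\<forall>x\<in>X. norm (T x) \<le> norm x)"

definition isometric :: "'a::chilbert set \<Rightarrow> 'b::chilbert set \<Rightarrow> ('a \<Rightarrow> 'b) \<Rightarrow> bool"
  where "isometric X Y T \<longleftrightarrow> T \<in> bop X Y \<and> (\<forall>x\<in>X. norm (T x) = norm x)"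

text \<open>The adjoint of an operator with domain \<open>X\<close>; its codomain only restricts
  the vectors \<open>y\<close> to which the adjoint is applied.\<close>

definition adj :: "'a::chilbert set \<Rightarrow> ('a \<Rightarrow> 'b::chilbert) \<Rightarrow> 'b \<Rightarrow> 'a"
  where "adj X T y = (THE z. z \<in> X \<and> (\<forall>x\<in>X. cinner (T x) y = cinner x z))"

definition coisometric :: "'a::chilbert set \<Rightarrow> 'b::chilbert set \<Rightarrow> ('a \<Rightarrow> 'b) \<Rightarrow> bool"
  where "coisometric X Y T \<longleftrightarrow> T \<in> bop X Y \<and> isometric Y X (adj X T)"

definition positive_op :: "'a::chilbert set \<Rightarrow> ('a \<Rightarrow> 'a) \<Rightarrow> bool"
  where "positive_op X R \<longleftrightarrow> R \<in> bop X X \<and> (\<forall>x\<in>X. cinner (R x) x \<in> \<real>\<^sub>\<ge>\<^sub>0)"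

text \<open>The nonnegative square root is unique only on \<open>X\<close>, hence \<open>SOME\<close>
  instead of \<open>THE\<close>.\<close>

definition op_sqrt :: "'a::chilbert set \<Rightarrow> ('a \<Rightarrow> 'a) \<Rightarrow> 'a \<Rightarrow> 'a"
  where "op_sqrt X P = (SOME R. positive_op X R \<and> (\<forall>x\<in>X. R (R x) = P x))"

definition defect :: "'a::chilbert set \<Rightarrow> ('a \<Rightarrow> 'b::chilbert) \<Rightarrow> 'a \<Rightarrow> 'a"
  where "defect X T = op_sqrt X (\<lambda>x. x - adj X T (T x))"

definition defect_space :: "'a::chilbert set \<Rightarrow> ('a \<Rightarrow> 'b::chilbert) \<Rightarrow> 'a set"
  where "defect_space X T = closure (defect X T ` X)"


section \<open>Linear systems\<close>

text \<open>\<open>System A B C D H M N\<close> has the blocks \<open>A\<close>, \<open>B\<close>, \<open>C\<close>, \<open>D\<close> and the state, input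
  and output spaces \<open>H\<close>, \<open>M\<close>, \<open>N\<close>.\<close>

datatype ('h, 'm, 'n) system =
  System (opA: "'h \<Rightarrow> 'h") (opB: "'m \<Rightarrow> 'h") (opC: "'h \<Rightarrow> 'n") (opD: "'m \<Rightarrow> 'n")
    (stsp: "'h set") (insp: "'m set") (outsp: "'n set")

definition linear_system :: "('h::chilbert, 'm::chilbert, 'n::chilbert) system \<Rightarrow> bool"
  where "linear_system \<tau> \<longleftrightarrow> hilbert (stsp \<tau>) \<and> hilbert (insp \<tau>) \<and> hilbert (outsp \<tau>) \<and>
    opA \<tau> \<in> bop (stsp \<tau>) (stsp \<tau>) \<and> opB \<tau> \<in> bop (insp \<tau>) (stsp \<tau>) \<and>
    opC \<tau> \<in> bop (stsp \<tau>) (outsp \<tau>) \<and> opD \<tau> \<in> bop (insp \<tau>) (outsp \<tau>)"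

definition block_op :: "('h::chilbert, 'm::chilbert, 'n::chilbert) system \<Rightarrow> 'h \<times> 'm \<Rightarrow> 'h \<times> 'n"
  where "block_op \<tau> = (\<lambda>(h, m). (opA \<tau> h + opB \<tau> m, opC \<tau> h + opD \<tau> m))"

definition passive_system :: "('h::chilbert, 'm::chilbert, 'n::chilbert) system \<Rightarrow> bool"
  where "passive_system \<tau> \<longleftrightarrow> linear_system \<tau> \<and>
    contraction (stsp \<tau> \<times> insp \<tau>) (stsp \<tau> \<times> outsp \<tau>) (block_op \<tau>)"

definition isometric_system :: "('h::chilbert, 'm::chilbert, 'n::chilbert) system \<Rightarrow> bool"
  where "isometric_system \<tau> \<longleftrightarrow> linear_system \<tau> \<and>
    isometric (stsp \<tau> \<times> insp \<tau>) (stsp \<tau> \<times> outsp \<tau>) (block_op \<tau>)"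

definition coisometric_system :: "('h::chilbert, 'm::chilbert, 'n::chilbert) system \<Rightarrow> bool"
  where "coisometric_system \<tau> \<longleftrightarrow> linear_system \<tau> \<and>
    coisometric (stsp \<tau> \<times> insp \<tau>) (stsp \<tau> \<times> outsp \<tau>) (block_op \<tau>)"

text \<open>Meaningful for those \<open>z\<close> for which \<open>I - zA\<close> is invertible on the state space.\<close>

definition transfer_function ::
  "('h::chilbert, 'm::chilbert, 'n::chilbert) system \<Rightarrow> complex \<Rightarrow> 'm \<Rightarrow> 'n"
  where "transfer_function \<tau> z m =
    opD \<tau> m + z *\<^sub>C opC \<tau> (inv_into (stsp \<tau>) (\<lambda>h. h - z *\<^sub>C opA \<tau> h) (opB \<tau> m))"

definition closed_cspan :: "'a::chilbert set \<Rightarrow> 'a set"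
  where "closed_cspan X = closure (csubspace hull X)"

definition controllable_subspace :: "('h::chilbert, 'm::chilbert, 'n::chilbert) system \<Rightarrow> 'h set"
  where "controllable_subspace \<tau> = closed_cspan {(opA \<tau> ^^ k) (opB \<tau> m) | k m. m \<in> insp \<tau>}"

definition observable_subspace :: "('h::chilbert, 'm::chilbert, 'n::chilbert) system \<Rightarrow> 'h set"
  where "observable_subspace \<tau> = closed_cspan
    {(adj (stsp \<tau>) (opA \<tau>) ^^ k) (adj (stsp \<tau>) (opC \<tau>) y) | k y. y \<in> outsp \<tau>}"

definition controllable :: "('h::chilbert, 'm::chilbert, 'n::chilbert) system \<Rightarrow> bool"
  where "controllable \<tau> \<longleftrightarrow> controllable_subspace \<tau> = stsp \<tau>"

definition observable :: "('h::chilbert, 'm::chilbert, 'n::chilbert) system \<Rightarrow> bool"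
  where "observable \<tau> \<longleftrightarrow> observable_subspace \<tau> = stsp \<tau>"

definition minimal_system :: "('h::chilbert, 'm::chilbert, 'n::chilbert) system \<Rightarrow> bool"
  where "minimal_system \<tau> \<longleftrightarrow> controllable \<tau> \<and> observable \<tau>"

definition simple_system :: "('h::chilbert, 'm::chilbert, 'n::chilbert) system \<Rightarrow> bool"
  where "simple_system \<tau> \<longleftrightarrow>
    stsp \<tau> = closure {x + y | x y. x \<in> controllable_subspace \<tau> \<and> y \<in> observable_subspace \<tau>}"


section \<open>The Schur class and Moebius parameters\<close>

text \<open>Complex differentiability with respect to the operator norm at every point of the
  open set \<open>U\<close>.\<close>

definition op_holomorphic_on ::
  "'a::chilbert set \<Rightarrow> 'b::chilbert set \<Rightarrow> (complex \<Rightarrow> 'a \<Rightarrow> 'b) \<Rightarrow> complex set \<Rightarrow> bool"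
  where "op_holomorphic_on X Y \<Theta> U \<longleftrightarrow> (\<forall>z\<in>U. \<exists>T\<in>bop X Y. \<forall>e>0. \<forall>\<^sub>F w in at z. \<forall>x\<in>X.
    norm (\<Theta> w x - \<Theta> z x - (w - z) *\<^sub>C T x) \<le> e * norm (w - z) * norm x)"

definition schur_class ::
  "'a::chilbert set \<Rightarrow> 'b::chilbert set \<Rightarrow> (complex \<Rightarrow> 'a \<Rightarrow> 'b) set"
  where "schur_class X Y =
    {\<Theta>. op_holomorphic_on X Y \<Theta> (ball 0 1) \<and> (\<forall>z\<in>ball 0 1. contraction X Y (\<Theta> z))}"

text \<open>The Moebius parameter is unique as a function on the disk with values in the operators
  between the defect spaces, that is, up to values outside these carriers.  Invertibility of
  \<open>I + \<Theta>(0)\<^sup>*Z(z)\<close> on the defect space of \<open>\<Theta>(0)\<close> is part of the definition.\<close>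

definition is_mobius_parameter ::
  "'m::chilbert set \<Rightarrow> 'n::chilbert set \<Rightarrow> (complex \<Rightarrow> 'm \<Rightarrow> 'n) \<Rightarrow> (complex \<Rightarrow> 'm \<Rightarrow> 'n) \<Rightarrow> bool"
  where "is_mobius_parameter M N \<Theta> Z \<longleftrightarrow>
    (let \<Theta>0 = \<Theta> 0; \<Theta>0s = adj M \<Theta>0;
         X = defect_space M \<Theta>0; Y = defect_space N \<Theta>0s
     in \<Theta> \<in> schur_class M N \<and> Z \<in> schur_class X Y \<and>
        (\<forall>z\<in>ball 0 1. bij_betw (\<lambda>u. u + \<Theta>0s (Z z u)) X X \<and>
          (\<forall>m\<in>M. \<Theta> z m = \<Theta>0 m +
            defect N \<Theta>0s (Z z (inv_into X (\<lambda>u. u + \<Theta>0s (Z z u)) (defect M \<Theta>0 m))))))"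

end

(*
  Let D = \<Theta>(0).  The operator (m, y) \<mapsto> (D m + D_{D*} y, D_D m - D* y) is unitary from the sum of the
  input space and the defect space of D* onto the sum of the output space and the defect space of D.
  The system \<tau> is obtained from \<nu> by feeding the output y = G h of \<nu> together with m into this
  operator and returning u = D_D m - D* y to \<nu> as input.  Hence \<tau> and \<nu> have the same energy
  balance, which settles passivity and isometry since the vectors u are dense; the coisometric and
  observable cases follow by passing to the dual systems, which are related in the same way.  The
  state operators differ by F D* G, whose range lies in the range of F, so the controllable
  subspaces agree.  Eliminating u from the equations of the feedback loop at frequency z gives the
  Moebius relation between the transfer functions.
*)

theory Submission
  imports Defs
begin

section \<open>Complex Hilbert spaces\<close>

text \<open>Both parts of the theorem are instances of one setting: bounded S, F, G around a
  contraction D, with S = D_{F*} L D_G in part (1) and D = \<Theta>(0) in part (2). Three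
  difficulties shape the rest. A defect operator is some chosen nonnegative square root, so whatever
  is known about it has to come from uniqueness of that root; building the root as a limit of
  polynomials in T*T yields uniqueness as well as T D_T = D_{T*} T, the relation that makes the
  feedback operator isometric and lets D* map one defect space into the other. Next, F is meaningful
  only on the defect space of D, where D_D has dense range, so facts about F are reached from F D_D
  by continuity. Finally, the Moebius parameter is given by a relation and not by a formula: its
  uniqueness rests on D_{D*} being injective on its own defect space.\<close>

lemma cinner_add_right: "cinner x (y + z) = cinner x y + cinner x (z::'a::chilbert)"
  by (metis cinner_add_left cinner_commute complex_cnj_add)

lemma cinner_scaleC_right: "cinner x (c *\<^sub>C y) = cnj c * cinner x (y::'a::chilbert)"
  by (metis cinner_commute cinner_scaleC_left complex_cnj_mult)

lemma cinner_self: "cinner x x = of_real ((norm (x::'a::chilbert))\<^sup>2)"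
proof (rule complex_eqI)
  show "Re (cinner x x) = Re (of_real ((norm x)\<^sup>2))"
    by (simp add: Re_cinner power2_norm_eq_inner)
  have "Im (cinner x x) = Im (cnj (cinner x x))"
    by (metis cinner_commute)
  then show "Im (cinner x x) = Im (of_real ((norm x)\<^sup>2))"
    by simp
qed

lemma norm_scaleC: "norm (c *\<^sub>C x) = cmod c * norm (x::'a::chilbert)"
proof -
  have "complex_of_real ((norm (c *\<^sub>C x))\<^sup>2) = of_real ((cmod c * norm x)\<^sup>2)"
    by (simp add: cinner_scaleC_left cinner_scaleC_right power_mult_distrib
        complex_norm_square mult.assoc flip: cinner_self of_real_power)
  then have "(norm (c *\<^sub>C x))\<^sup>2 = (cmod c * norm x)\<^sup>2"
    using of_real_eq_iff by blast
  then show ?thesis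
    by simp
qed

text \<open>Multiplying \<open>x\<close> by the conjugate phase of the inner product makes the
  product real and nonnegative, so the real Cauchy-Schwarz inequality applies.\<close>

lemma norm_cinner_le: "cmod (cinner x y) \<le> norm x * norm (y::'a::chilbert)"
proof -
  define c where "c = cnj (sgn (cinner x y))"
  have "cmod (cinner x y) = Re (c * cinner x y)"
  proof -
    have "c * cinner x y = of_real (cmod (cinner x y))"
      by (cases "cinner x y = 0")
        (simp_all add: c_def sgn_eq complex_norm_square[symmetric] mult.commute
          power2_eq_square[symmetric] divide_simps)
    then show ?thesis by simp
  qed
  also have "\<dots> = inner (c *\<^sub>C x) y"
    by (simp add: cinner_scaleC_left flip: Re_cinner)
  also have "\<dots> \<le> norm (c *\<^sub>C x) * norm y"
    by (rule norm_cauchy_schwarz)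
  also have "\<dots> \<le> norm x * norm y"
    by (intro mult_right_mono) (auto simp: norm_scaleC c_def norm_sgn)
  finally show ?thesis .
qed

lemma scaleC_scaleR_left: "(r *\<^sub>R c) *\<^sub>C x = r *\<^sub>R (c *\<^sub>C (x::'a::chilbert))"
  by (metis scaleC_of_real scaleC_scaleC scaleR_conv_of_real)

lemma scaleC_scaleR_right: "c *\<^sub>C (r *\<^sub>R x) = r *\<^sub>R (c *\<^sub>C (x::'a::chilbert))"
  by (metis mult.commute scaleC_of_real scaleC_scaleC)

interpretation scaleC: bounded_bilinear "scaleC :: complex \<Rightarrow> 'a::chilbert \<Rightarrow> 'a"
proof
  show "\<exists>K. \<forall>c x. norm (c *\<^sub>C (x::'a)) \<le> norm c * norm x * K"
    by (rule exI[of _ 1]) (simp add: norm_scaleC)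
qed (simp_all add: scaleC_add_left scaleC_add_right scaleC_scaleR_left scaleC_scaleR_right)

interpretation cinner: bounded_bilinear "cinner :: 'a::chilbert \<Rightarrow> 'a \<Rightarrow> complex"
proof
  show "cinner (r *\<^sub>R x) y = r *\<^sub>R cinner x y" for r and x y :: 'a
    by (metis cinner_scaleC_left scaleC_of_real scaleR_conv_of_real)
  show "cinner x (r *\<^sub>R y) = r *\<^sub>R cinner x y" for r and x y :: 'a
    by (metis cinner_scaleC_right complex_cnj_complex_of_real scaleC_of_real scaleR_conv_of_real)
  show "\<exists>K. \<forall>x y. cmod (cinner x (y::'a)) \<le> norm x * norm y * K"
    by (rule exI[of _ 1]) (simp add: norm_cinner_le)
qed (simp_all add: cinner_add_left cinner_add_right)

lemma scaleC_one: "1 *\<^sub>C x = (x::'a::chilbert)"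
  using scaleC_of_real[of 1 x] by simp

lemma csubspace_zero: "csubspace X \<Longrightarrow> 0 \<in> X"
  and csubspace_add: "csubspace X \<Longrightarrow> x \<in> X \<Longrightarrow> y \<in> X \<Longrightarrow> x + y \<in> X"
  and csubspace_scaleC: "csubspace X \<Longrightarrow> x \<in> X \<Longrightarrow> c *\<^sub>C x \<in> X"
  by (auto simp: csubspace_def)

lemma csubspace_scaleR: "csubspace X \<Longrightarrow> x \<in> X \<Longrightarrow> r *\<^sub>R x \<in> X"
  using csubspace_scaleC[of X x "of_real r"] by (simp add: scaleC_of_real)

lemma csubspace_minus: "csubspace X \<Longrightarrow> x \<in> X \<Longrightarrow> - x \<in> X"
  using csubspace_scaleR[of X x "-1"] by simp

lemma csubspace_diff: "csubspace X \<Longrightarrow> x \<in> X \<Longrightarrow> y \<in> X \<Longrightarrow> x - y \<in> X"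
  using csubspace_add[of X x "- y"] by (simp add: csubspace_minus)

lemmas csubspace_intros = csubspace_zero csubspace_add csubspace_scaleC csubspace_scaleR
  csubspace_minus csubspace_diff

lemma hilbert_csubspace: "hilbert X \<Longrightarrow> csubspace X"
  and hilbert_closed: "hilbert X \<Longrightarrow> closed X"
  by (simp_all add: hilbert_def)

lemma hilbert_UNIV: "hilbert UNIV"
  by (simp add: hilbert_def csubspace_def)

lemma csubspace_Times: "csubspace X \<Longrightarrow> csubspace Y \<Longrightarrow> csubspace (X \<times> Y)"
  by (auto simp: csubspace_def scaleC_prod_def zero_prod_def)

lemma csubspace_closure:
  assumes "csubspace X"
  shows "csubspace (closure X)"
  unfolding csubspace_def
proof (intro conjI ballI allI)
  show "0 \<in> closure X"
    using assms closure_subset csubspace_zero by blast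
  fix x assume "x \<in> closure X"
  then obtain f where f: "\<And>n. f n \<in> X" "f \<longlonglongrightarrow> x"
    by (auto simp: closure_sequential)
  show "c *\<^sub>C x \<in> closure X" for c
    using f assms scaleC.tendsto[OF tendsto_const f(2), of c]
    by (auto simp: closure_sequential intro!: exI[of _ "\<lambda>n. c *\<^sub>C f n"] csubspace_intros)
  fix y assume "y \<in> closure X"
  then obtain g where g: "\<And>n. g n \<in> X" "g \<longlonglongrightarrow> y"
    by (auto simp: closure_sequential)
  show "x + y \<in> closure X"
    using f g assms tendsto_add[OF f(2) g(2)]
    by (auto simp: closure_sequential intro!: exI[of _ "\<lambda>n. f n + g n"] csubspace_intros)
qed

lemma hilbert_closure: "csubspace X \<Longrightarrow> hilbert (closure X)"
  by (simp add: hilbert_def csubspace_closure)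


section \<open>Bounded operators\<close>

lemma bop_app: "T \<in> bop X Y \<Longrightarrow> x \<in> X \<Longrightarrow> T x \<in> Y"
  and bop_add: "T \<in> bop X Y \<Longrightarrow> x \<in> X \<Longrightarrow> y \<in> X \<Longrightarrow> T (x + y) = T x + T y"
  and bop_scaleC: "T \<in> bop X Y \<Longrightarrow> x \<in> X \<Longrightarrow> T (c *\<^sub>C x) = c *\<^sub>C T x"
  by (auto simp: bop_def)

lemma bop_scaleR: "T \<in> bop X Y \<Longrightarrow> x \<in> X \<Longrightarrow> T (r *\<^sub>R x) = r *\<^sub>R T x"
  by (metis bop_scaleC scaleC_of_real)

lemma bop_minus: "T \<in> bop X Y \<Longrightarrow> x \<in> X \<Longrightarrow> T (- x) = - T x"
  using bop_scaleR[of T X Y x "-1"] by simp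

lemma bop_diff: "csubspace X \<Longrightarrow> T \<in> bop X Y \<Longrightarrow> x \<in> X \<Longrightarrow> y \<in> X \<Longrightarrow> T (x - y) = T x - T y"
  using bop_add[of T X Y x "- y"] by (simp add: bop_minus csubspace_minus)

lemma bop_zero: "csubspace X \<Longrightarrow> T \<in> bop X Y \<Longrightarrow> T 0 = 0"
  by (metis bop_scaleR csubspace_zero scaleR_zero_left)

lemma bop_bound:
  assumes "T \<in> bop X Y"
  obtains K where "K \<ge> 0" "\<And>x. x \<in> X \<Longrightarrow> norm (T x) \<le> K * norm x"
proof -
  obtain K where K: "\<forall>x\<in>X. norm (T x) \<le> K * norm x"
    using assms by (auto simp: bop_def)
  have "norm (T x) \<le> max K 0 * norm x" if "x \<in> X" for x
    using K that by (meson max.cobounded1 mult_right_mono norm_ge_zero order_trans)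
  then show ?thesis
    by (intro that[of "max K 0"]) auto
qed

lemma bopI:
  assumes "\<And>x. x \<in> X \<Longrightarrow> T x \<in> Y"
    and "\<And>x y. x \<in> X \<Longrightarrow> y \<in> X \<Longrightarrow> T (x + y) = T x + T y"
    and "\<And>c x. x \<in> X \<Longrightarrow> T (c *\<^sub>C x) = c *\<^sub>C T x"
    and "\<And>x. x \<in> X \<Longrightarrow> norm (T x) \<le> K * norm x"
  shows "T \<in> bop X Y"
  using assms unfolding bop_def by blast

lemma bop_subset: "T \<in> bop X Y \<Longrightarrow> X' \<subseteq> X \<Longrightarrow> Y \<subseteq> Y' \<Longrightarrow> T \<in> bop X' Y'"
  unfolding bop_def by blast

lemma bop_codomain: "T \<in> bop X Y \<Longrightarrow> (\<And>x. x \<in> X \<Longrightarrow> T x \<in> Z) \<Longrightarrow> T \<in> bop X Z"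
  unfolding bop_def by simp

lemma bop_compose:
  assumes S: "S \<in> bop Y Z" and T: "T \<in> bop X Y"
  shows "(\<lambda>x. S (T x)) \<in> bop X Z"
proof -
  obtain K where K: "K \<ge> 0" "\<And>y. y \<in> Y \<Longrightarrow> norm (S y) \<le> K * norm y"
    using bop_bound[OF S] by blast
  obtain K' where K': "K' \<ge> 0" "\<And>x. x \<in> X \<Longrightarrow> norm (T x) \<le> K' * norm x"
    using bop_bound[OF T] by blast
  show ?thesis
  proof (rule bopI)
    fix x assume "x \<in> X"
    then have "norm (S (T x)) \<le> K * norm (T x)"
      using K T bop_app by blast
    also have "\<dots> \<le> K * (K' * norm x)"
      using K' K \<open>x \<in> X\<close> by (intro mult_left_mono) auto
    finally show "norm (S (T x)) \<le> (K * K') * norm x"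
      by (simp add: mult.assoc)
  qed (use S T in \<open>auto simp: bop_add bop_scaleC bop_app\<close>)
qed

lemma bop_plus:
  assumes Y: "csubspace Y" and S: "S \<in> bop X Y" and T: "T \<in> bop X Y"
  shows "(\<lambda>x. S x + T x) \<in> bop X Y"
proof -
  obtain K where K: "K \<ge> 0" "\<And>y. y \<in> X \<Longrightarrow> norm (S y) \<le> K * norm y"
    using bop_bound[OF S] by blast
  obtain K' where K': "K' \<ge> 0" "\<And>x. x \<in> X \<Longrightarrow> norm (T x) \<le> K' * norm x"
    using bop_bound[OF T] by blast
  show ?thesis
  proof (rule bopI)
    fix x assume "x \<in> X"
    then show "norm (S x + T x) \<le> (K + K') * norm x"
      using K K' norm_triangle_mono by (fastforce simp: algebra_simps)
  qed (use S T Y in \<open>auto simp: bop_add bop_scaleC bop_app csubspace_intros scaleC_add_right\<close>)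
qed

lemma bop_scaleC_fun:
  assumes Y: "csubspace Y" and T: "T \<in> bop X Y"
  shows "(\<lambda>x. c *\<^sub>C T x) \<in> bop X Y"
proof -
  obtain K' where K': "K' \<ge> 0" "\<And>x. x \<in> X \<Longrightarrow> norm (T x) \<le> K' * norm x"
    using bop_bound[OF T] by blast
  show ?thesis
  proof (rule bopI)
    fix x assume "x \<in> X"
    then show "norm (c *\<^sub>C T x) \<le> (cmod c * K') * norm x"
      using K' by (simp add: norm_scaleC mult.assoc mult_left_mono)
  qed (use T Y in \<open>auto simp: bop_add bop_scaleC bop_app csubspace_intros scaleC_add_right
        scaleC_scaleC mult.commute\<close>)
qed

lemma bop_uminus: "csubspace Y \<Longrightarrow> T \<in> bop X Y \<Longrightarrow> (\<lambda>x. - T x) \<in> bop X Y"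
  using bop_scaleC_fun[of Y T X "-1"] by (simp add: scaleC.minus_left scaleC_one)

lemma bop_minus_fun:
  "csubspace Y \<Longrightarrow> S \<in> bop X Y \<Longrightarrow> T \<in> bop X Y \<Longrightarrow> (\<lambda>x. S x - T x) \<in> bop X Y"
  using bop_plus[of Y S X "\<lambda>x. - T x"] by (simp add: bop_uminus)

lemma bop_id: "X \<subseteq> Y \<Longrightarrow> (\<lambda>x. x) \<in> bop X Y"
  by (rule bopI[where K = 1]) auto

lemma bop_null: "csubspace Y \<Longrightarrow> (\<lambda>_. 0) \<in> bop X Y"
  by (rule bopI[where K = 0]) (auto simp: csubspace_intros scaleC.zero_right)

lemma bop_continuous_on:
  assumes "csubspace X" "T \<in> bop X Y"
  shows "continuous_on X T"
proof -
  obtain K where K: "K \<ge> 0" "\<And>x. x \<in> X \<Longrightarrow> norm (T x) \<le> K * norm x"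
    using bop_bound[OF assms(2)] by blast
  have "K-lipschitz_on X T"
    by (rule lipschitz_onI)
      (use K assms in \<open>auto simp: dist_norm csubspace_diff simp flip: bop_diff\<close>)
  then show ?thesis
    by (rule lipschitz_on_continuous_on)
qed

lemma bop_image_csubspace:
  assumes "csubspace X" "T \<in> bop X Y"
  shows "csubspace (T ` X)"
  unfolding csubspace_def
proof (intro conjI ballI allI)
  show "0 \<in> T ` X"
    by (metis assms bop_zero csubspace_zero imageI)
  show "x + y \<in> T ` X" if "x \<in> T ` X" "y \<in> T ` X" for x y
    using that assms by (auto simp: csubspace_add simp flip: bop_add)
  show "c *\<^sub>C x \<in> T ` X" if "x \<in> T ` X" for c x
    using that assms by (auto simp: csubspace_scaleC simp flip: bop_scaleC)
qed

text \<open>Continuity extends membership in a closed set from a dense subset to the whole domain.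
  It is applied with \<open>E\<close> the range of a defect operator, or the span of the vectors
  that generate a controllable subspace.\<close>

lemma bop_closure_into:
  assumes "csubspace X" "T \<in> bop X Z" "closed Y" "E \<subseteq> X" "X \<subseteq> closure E" "closed X"
    and "\<And>x. x \<in> E \<Longrightarrow> T x \<in> Y"
    and "x \<in> X"
  shows "T x \<in> Y"
proof -
  have "closure E = X"
    using assms by (simp add: closure_minimal subset_antisym)
  then have "T ` closure E \<subseteq> Y"
    using assms bop_continuous_on[OF assms(1,2)]
    by (intro image_closure_subset) auto
  then show ?thesis
    using \<open>closure E = X\<close> assms(8) by blast
qed

lemma contraction_bop: "contraction X Y T \<Longrightarrow> T \<in> bop X Y"
  and contraction_norm: "contraction X Y T \<Longrightarrow> x \<in> X \<Longrightarrow> norm (T x) \<le> norm x"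
  by (simp_all add: contraction_def)

section \<open>Variational arguments and the Riesz representation theorem\<close>

lemma quadratic_nonneg_imp_linear_zero:
  fixes a b :: real
  assumes "\<And>t. 0 \<le> t * a + t\<^sup>2 * b"
  shows "a = 0"
proof (rule ccontr)
  assume "a \<noteq> 0"
  \<comment> \<open>Any positive number above \<open>b\<close> serves: at t = -a/s the quadratic
    equals (a/s)^2 (b - s), which is negative.\<close>
  define s where "s = \<bar>b\<bar> + 1"
  have s: "s > 0" "b < s"
    by (auto simp: s_def)
  have "0 \<le> (- a / s) * a + (- a / s)\<^sup>2 * b"
    by (rule assms)
  also have "\<dots> = (a\<^sup>2 / s\<^sup>2) * (b - s)"
    using s by (simp add: field_simps power2_eq_square)
  also have "\<dots> < 0"
    using \<open>a \<noteq> 0\<close> s by (intro mult_pos_neg) auto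
  finally show False
    by simp
qed

text \<open>The representing vector minimizes \<open>\<parallel>x\<parallel>\<^sup>2 - 2 Re (\<phi> x)\<close>; the parallelogram law makes
  minimizing sequences Cauchy.\<close>

lemma riesz_representation:
  fixes \<phi> :: "'a::chilbert \<Rightarrow> complex"
  assumes X: "hilbert X"
    and add: "\<And>x y. x \<in> X \<Longrightarrow> y \<in> X \<Longrightarrow> \<phi> (x + y) = \<phi> x + \<phi> y"
    and scale: "\<And>c x. x \<in> X \<Longrightarrow> \<phi> (c *\<^sub>C x) = c * \<phi> x"
    and bound: "\<And>x. x \<in> X \<Longrightarrow> cmod (\<phi> x) \<le> K * norm x"
  shows "\<exists>z\<in>X. \<forall>x\<in>X. \<phi> x = cinner x z"
proof -
  note sub = hilbert_csubspace[OF X]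
  define f where "f x = Re (\<phi> x)" for x
  have f_add: "f (x + y) = f x + f y" if "x \<in> X" "y \<in> X" for x y
    using that by (simp add: f_def add)
  have f_scale: "f (r *\<^sub>R x) = r * f x" if "x \<in> X" for r x
    using that scale[of x "of_real r"] by (simp add: f_def scaleC_of_real)
  have f_bound: "\<bar>f x\<bar> \<le> K * norm x" if "x \<in> X" for x
    using bound[OF that] abs_Re_le_cmod[of "\<phi> x"] by (simp add: f_def)
  define J where "J x = (norm x)\<^sup>2 - 2 * f x" for x
  have J_ge: "- K\<^sup>2 \<le> J x" if "x \<in> X" for x
  proof -
    \<comment> \<open>Completing the square: J x \<ge> ||x||^2 - 2 K ||x|| \<ge> -K^2.\<close>
    have "0 \<le> (norm x - K)\<^sup>2" by simp
    then show ?thesis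
      using f_bound[OF that] by (simp add: J_def power2_eq_square algebra_simps)
  qed
  define m where "m = Inf (J ` X)"
  have bdd: "bdd_below (J ` X)"
    using J_ge by (intro bdd_belowI2)
  have m_le: "m \<le> J x" if "x \<in> X" for x
    unfolding m_def using bdd that by (intro cInf_lower) auto
  have "\<exists>x\<in>X. J x < m + 1 / (real n + 1)" for n
  proof -
    have "Inf (J ` X) < m + 1 / (real n + 1)"
      by (simp add: m_def)
    then show ?thesis
      using cInf_lessD[of "J ` X"] csubspace_zero[OF sub] by blast
  qed
  then obtain s where s: "\<And>n. s n \<in> X" "\<And>n. J (s n) < m + 1 / (real n + 1)"
    by metis
  have par: "(norm (a - b))\<^sup>2 \<le> 2 * (J a - m) + 2 * (J b - m)" if "a \<in> X" "b \<in> X" for a b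
  proof -
    define c where "c = (1/2) *\<^sub>R (a + b)"
    have c: "c \<in> X"
      unfolding c_def using that sub by (intro csubspace_intros)
    have "f c = (f a + f b) / 2"
      using that sub by (simp add: c_def f_scale f_add csubspace_add)
    moreover have "4 * (norm c)\<^sup>2 + (norm (a - b))\<^sup>2 = 2 * (norm a)\<^sup>2 + 2 * (norm b)\<^sup>2"
      unfolding power2_norm_eq_inner by (simp add: c_def inner_simps inner_commute field_simps)
    ultimately have "(norm (a - b))\<^sup>2 = 2 * J a + 2 * J b - 4 * J c"
      by (simp add: J_def)
    then show ?thesis
      using m_le[OF c] by (simp add: algebra_simps)
  qed
  have "Cauchy s"
  proof (rule CauchyI)
    fix e :: real assume e: "0 < e"
    \<comment> \<open>\<open>par\<close> counts the excess of \<open>J\<close> over \<open>m\<close>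
      twice at each of the two points, so each excess has to stay below e^2/4.\<close>
    obtain N where N: "4 / (real N + 1) < e\<^sup>2"
    proof -
      obtain N where "real N > 4 / e\<^sup>2"
        using reals_Archimedean2 by blast
      then have "4 / (real N + 1) < e\<^sup>2"
        using e by (simp add: field_simps) (smt (verit) zero_less_power)
      then show ?thesis by (rule that)
    qed
    have small: "J (s n) - m < e\<^sup>2 / 4" if "n \<ge> N" for n
    proof -
      have "1 / (real n + 1) \<le> 1 / (real N + 1)"
        using that by (intro divide_left_mono) auto
      then show ?thesis
        using s(2)[of n] N by linarith
    qed
    show "\<exists>M. \<forall>k\<ge>M. \<forall>n\<ge>M. norm (s k - s n) < e"
    proof (intro exI[of _ N] allI impI)
      fix k n assume "N \<le> k" "N \<le> n"
      then have "(norm (s k - s n))\<^sup>2 < e\<^sup>2"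
        using par[OF s(1) s(1), of k n] small[OF \<open>N \<le> k\<close>] small[OF \<open>N \<le> n\<close>]
        by (simp add: algebra_simps)
      then show "norm (s k - s n) < e"
        using e by (simp add: power_less_imp_less_base)
    qed
  qed
  then obtain z where z: "s \<longlonglongrightarrow> z"
    using convergent_eq_Cauchy by blast
  have "z \<in> X"
    using s(1) z hilbert_closed[OF X] closed_sequentially by blast
  have fz: "(\<lambda>n. f (s n)) \<longlonglongrightarrow> f z"
  proof (rule metric_tendsto_imp_tendsto)
    show "(\<lambda>n. K *\<^sub>R (s n - z)) \<longlonglongrightarrow> 0"
      using z by (auto intro!: tendsto_eq_intros)
    have "\<bar>f (s n) - f z\<bar> \<le> \<bar>K\<bar> * norm (s n - z)" for n
    proof -
      have "f (s n) = f (s n - z) + f z"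
        using f_add[of "s n - z" z] s(1) \<open>z \<in> X\<close> sub by (simp add: csubspace_diff)
      then have "\<bar>f (s n) - f z\<bar> \<le> K * norm (s n - z)"
        using f_bound[of "s n - z"] s(1) \<open>z \<in> X\<close> sub by (simp add: csubspace_diff)
      also have "\<dots> \<le> \<bar>K\<bar> * norm (s n - z)"
        by (intro mult_right_mono) auto
      finally show ?thesis .
    qed
    then show "\<forall>\<^sub>F n in sequentially. dist (f (s n)) (f z) \<le> dist (K *\<^sub>R (s n - z)) 0"
      by (simp add: dist_norm)
  qed
  have "(\<lambda>n. J (s n)) \<longlonglongrightarrow> J z"
    unfolding J_def by (intro tendsto_intros z fz)
  moreover have "(\<lambda>n. m + 1 / (real n + 1)) \<longlonglongrightarrow> m + 0"
    using LIMSEQ_Suc[OF lim_1_over_n[where 'a=real]]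
    by (intro tendsto_intros) (simp add: add.commute)
  ultimately have Jz: "J z \<le> m"
    by (intro LIMSEQ_le[of "\<lambda>n. J (s n)" _ "\<lambda>n. m + 1 / (real n + 1)"])
      (use s(2) less_imp_le in auto)
  \<comment> \<open>Since \<open>z\<close> minimizes \<open>J\<close> on \<open>X\<close>, the first
    variation in every direction \<open>x\<close> vanishes; here it is 2 (inner x z - f x).\<close>
  have real_rep: "f x = inner x z" if "x \<in> X" for x
  proof -
    have "0 \<le> t * (2 * (inner x z - f x)) + t\<^sup>2 * (norm x)\<^sup>2" for t
    proof -
      have "z + t *\<^sub>R x \<in> X"
        using that \<open>z \<in> X\<close> sub by (intro csubspace_intros)
      then have "J z \<le> J (z + t *\<^sub>R x)"
        using Jz m_le by force
      moreover have "J (z + t *\<^sub>R x) = J z + t * (2 * (inner x z - f x)) + t\<^sup>2 * (norm x)\<^sup>2"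
      proof -
        have "f (z + t *\<^sub>R x) = f z + t * f x"
          using that \<open>z \<in> X\<close> sub by (simp add: f_add f_scale csubspace_scaleR)
        moreover have "(norm (z + t *\<^sub>R x))\<^sup>2 = (norm z)\<^sup>2 + 2 * (t * inner x z) + t\<^sup>2 * (norm x)\<^sup>2"
          unfolding power2_norm_eq_inner
          by (simp add: inner_simps inner_commute power2_eq_square)
        ultimately show ?thesis
          by (simp add: J_def algebra_simps)
      qed
      ultimately show ?thesis by simp
    qed
    then have "2 * (inner x z - f x) = 0"
      by (rule quadratic_nonneg_imp_linear_zero)
    then show ?thesis by simp
  qed
  have "\<phi> x = cinner x z" if "x \<in> X" for x
  proof (rule complex_eqI)
    show "Re (\<phi> x) = Re (cinner x z)"
      using real_rep[OF that] by (simp add: f_def Re_cinner)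
    \<comment> \<open>The real identity at i x recovers the imaginary parts, because Re (i c) = -Im
      c.\<close>
    have "f (\<i> *\<^sub>C x) = Re (cinner (\<i> *\<^sub>C x) z)"
      using real_rep[of "\<i> *\<^sub>C x"] that sub by (simp add: csubspace_scaleC Re_cinner)
    then show "Im (\<phi> x) = Im (cinner x z)"
      using that by (simp add: f_def scale cinner_scaleC_left)
  qed
  then show ?thesis
    using \<open>z \<in> X\<close> by blast
qed


section \<open>Adjoints\<close>

lemma eq_if_cinner_eq:
  assumes "csubspace X" "y \<in> X" "z \<in> X" "\<And>x. x \<in> X \<Longrightarrow> cinner x y = cinner x z"
  shows "y = z"
proof -
  have "cinner (y - z) (y - z) = 0"
    using assms(4)[of "y - z"] assms by (simp add: cinner.diff_right csubspace_diff)
  then show ?thesis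
    by (simp add: cinner_self)
qed

lemma adj_eqI:
  assumes "csubspace X" "z \<in> X" "\<And>x. x \<in> X \<Longrightarrow> cinner (T x) y = cinner x z"
  shows "adj X T y = z"
  unfolding adj_def
  by (rule the_equality) (use assms eq_if_cinner_eq[of X] in auto)

text \<open>The functional x \<mapsto> <T x, y> is bounded on \<open>X\<close>, so its Riesz vector
  exists and the definite description in \<open>adj\<close> denotes it. This holds for every
  \<open>y\<close> of the codomain type, which is why adjoints later satisfy equations between
  functions.\<close>

lemma adj_mem_and_cinner:
  assumes X: "hilbert X" and T: "T \<in> bop X Y"
  shows "adj X T y \<in> X \<and> (\<forall>x\<in>X. cinner (T x) y = cinner x (adj X T y))"
proof -
  obtain K where K: "K \<ge> 0" "\<And>x. x \<in> X \<Longrightarrow> norm (T x) \<le> K * norm x"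
    using bop_bound[OF T] by blast
  have "cmod (cinner (T x) y) \<le> (K * norm y) * norm x" if "x \<in> X" for x
  proof -
    have "cmod (cinner (T x) y) \<le> norm (T x) * norm y"
      by (rule norm_cinner_le)
    also have "\<dots> \<le> (K * norm x) * norm y"
      using K that by (intro mult_right_mono) auto
    finally show ?thesis by (simp add: mult_ac)
  qed
  then obtain z where "z \<in> X" "\<forall>x\<in>X. cinner (T x) y = cinner x z"
    using riesz_representation[OF X, of "\<lambda>x. cinner (T x) y" "K * norm y"] T
    by (auto simp: bop_add bop_scaleC cinner_add_left cinner_scaleC_left)
  moreover from this have "adj X T y = z"
    using X by (intro adj_eqI) (auto simp: hilbert_csubspace)
  ultimately show ?thesis by simp
qed

lemma adj_mem: "hilbert X \<Longrightarrow> T \<in> bop X Y \<Longrightarrow> adj X T y \<in> X"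
  and cinner_adj:
    "hilbert X \<Longrightarrow> T \<in> bop X Y \<Longrightarrow> x \<in> X \<Longrightarrow> cinner (T x) y = cinner x (adj X T y)"
  using adj_mem_and_cinner by blast+

lemma cinner_adj_left:
  "hilbert X \<Longrightarrow> T \<in> bop X Y \<Longrightarrow> x \<in> X \<Longrightarrow> cinner (adj X T y) x = cinner y (T x)"
  by (metis cinner_adj cinner_commute)

text \<open>With z = T* y one has ||z||^2 = <T z, y> \<le> K ||z|| ||y||, and one factor ||z||
  cancels.\<close>

lemma norm_adj_le:
  assumes X: "hilbert X" and T: "T \<in> bop X Y"
    and K: "K \<ge> 0" "\<And>x. x \<in> X \<Longrightarrow> norm (T x) \<le> K * norm x"
  shows "norm (adj X T y) \<le> K * norm y"
proof -
  let ?z = "adj X T y"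
  have z: "?z \<in> X"
    using adj_mem[OF X T] .
  have "(norm ?z)\<^sup>2 = cmod (cinner ?z ?z)"
    by (simp add: cinner_self norm_power)
  also have "\<dots> = cmod (cinner (T ?z) y)"
    using cinner_adj[OF X T z] by simp
  also have "\<dots> \<le> norm (T ?z) * norm y"
    by (rule norm_cinner_le)
  also have "\<dots> \<le> (K * norm ?z) * norm y"
    using K z by (intro mult_right_mono) auto
  finally have "norm ?z * norm ?z \<le> norm ?z * (K * norm y)"
    by (simp add: power2_eq_square mult_ac)
  then show ?thesis
    using K by (cases "norm ?z = 0") (simp_all add: mult_le_cancel_left)
qed

text \<open>\<open>Z\<close> is arbitrary because the adjoint is defined and bounded on the whole
  codomain type; linearity comes from uniqueness of the representing vector.\<close>

lemma adj_bop:
  assumes X: "hilbert X" and T: "T \<in> bop X Y"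
  shows "adj X T \<in> bop Z X"
proof -
  note sub = hilbert_csubspace[OF X]
  obtain K where K: "K \<ge> 0" "\<And>x. x \<in> X \<Longrightarrow> norm (T x) \<le> K * norm x"
    using bop_bound[OF T] by blast
  show ?thesis
  proof (rule bopI)
    show "adj X T (x + y) = adj X T x + adj X T y" for x y
      using adj_mem[OF X T] cinner_adj[OF X T] sub
      by (intro adj_eqI) (auto simp: cinner_add_right csubspace_add)
    show "adj X T (c *\<^sub>C x) = c *\<^sub>C adj X T x" for c x
      using adj_mem[OF X T] cinner_adj[OF X T] sub
      by (intro adj_eqI) (auto simp: cinner_scaleC_right csubspace_scaleC)
    show "norm (adj X T y) \<le> K * norm y" for y
      by (rule norm_adj_le[OF X T K])
  qed (use adj_mem[OF X T] in auto)
qed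

lemma contraction_adj:
  assumes "hilbert X" "contraction X Y T"
  shows "contraction Z X (adj X T)"
  using assms norm_adj_le[OF assms(1), of T Y 1] adj_bop[OF assms(1)]
  by (auto simp: contraction_def)

lemma adj_adj:
  assumes "hilbert X" "csubspace Y" "T \<in> bop X Y" "x \<in> X"
  shows "adj Y (adj X T) x = T x"
  using assms by (intro adj_eqI) (auto simp: cinner_adj_left bop_app)

section \<open>Square roots and defect operators\<close>

text \<open>\<open>I\<close> minus the limit of this iteration is the nonnegative square root of \<open>I - K\<close>: the limit
  \<open>Y\<close> satisfies \<open>2 Y = K + Y\<^sup>2\<close>.\<close>

primrec sqrt_iter :: "('a::chilbert \<Rightarrow> 'a) \<Rightarrow> nat \<Rightarrow> 'a \<Rightarrow> 'a"
  where "sqrt_iter K 0 = (\<lambda>_. 0)"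
  | "sqrt_iter K (Suc n) = (\<lambda>x. (1/2) *\<^sub>R (K x + sqrt_iter K n (sqrt_iter K n x)))"

text \<open>The same iteration for the scalar K = 1. This is the extreme case, increasing to 1, and
  it dominates the iteration for every contraction.\<close>

primrec sqrt_majorant :: "nat \<Rightarrow> real"
  where "sqrt_majorant 0 = 0"
  | "sqrt_majorant (Suc n) = (1 + (sqrt_majorant n)\<^sup>2) / 2"

text \<open>A pointwise limit suffices because the iterates are uniformly contractive on the
  carrier.\<close>

definition sqrt_lim :: "('a::chilbert \<Rightarrow> 'a) \<Rightarrow> 'a \<Rightarrow> 'a"
  where "sqrt_lim K x = lim (\<lambda>n. sqrt_iter K n x)"

lemma sqrt_majorant_bounds: "0 \<le> sqrt_majorant n" "sqrt_majorant n \<le> 1"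
proof -
  have "0 \<le> sqrt_majorant n \<and> sqrt_majorant n \<le> 1"
    by (induction n) (auto simp: power_le_one)
  then show "0 \<le> sqrt_majorant n" "sqrt_majorant n \<le> 1"
    by auto
qed

lemma convergent_sqrt_majorant: "convergent sqrt_majorant"
proof (rule Bseq_monoseq_convergent)
  show "Bseq sqrt_majorant"
    by (rule BseqI'[of _ 1]) (use sqrt_majorant_bounds in auto)
  \<comment> \<open>The increment is (1 - a)^2 / 2 for a = \<open>sqrt_majorant n\<close>.\<close>
  have "sqrt_majorant n \<le> sqrt_majorant (Suc n)" for n
    using zero_le_power2[of "1 - sqrt_majorant n"]
    by (simp add: power2_eq_square algebra_simps)
  then show "monoseq sqrt_majorant"
    by (simp add: monoseq_Suc)
qed

context
  fixes X :: "'a::chilbert set" and K :: "'a \<Rightarrow> 'a"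
  assumes X: "hilbert X" and K: "contraction X X K"
begin

lemma sqrt_iter_bop: "sqrt_iter K n \<in> bop X X"
proof (induction n)
  case 0
  then show ?case
    using X by (simp add: bop_null hilbert_csubspace)
next
  case (Suc n)
  have "(\<lambda>x. complex_of_real (1/2) *\<^sub>C (K x + sqrt_iter K n (sqrt_iter K n x))) \<in> bop X X"
    using X K Suc
    by (intro bop_scaleC_fun bop_plus bop_compose[OF Suc Suc]) (auto simp: hilbert_csubspace contraction_bop)
  then show ?case
    by (simp only: sqrt_iter.simps scaleC_of_real)
qed

lemma norm_sqrt_iter_le: "x \<in> X \<Longrightarrow> norm (sqrt_iter K n x) \<le> sqrt_majorant n * norm x"
proof (induction n arbitrary: x)
  case (Suc n)
  let ?y = "sqrt_iter K n x" and ?a = "sqrt_majorant n"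
  have "norm (sqrt_iter K n ?y) \<le> ?a * norm ?y"
    using Suc sqrt_iter_bop bop_app by blast
  also have "\<dots> \<le> ?a * (?a * norm x)"
    using Suc sqrt_majorant_bounds by (intro mult_left_mono) auto
  finally have "norm (K x + sqrt_iter K n ?y) \<le> norm x + ?a * (?a * norm x)"
    using contraction_norm[OF K Suc.prems] norm_triangle_mono by blast
  moreover have "norm (sqrt_iter K (Suc n) x) = norm (K x + sqrt_iter K n ?y) / 2"
    by simp
  ultimately show ?case
    by (simp add: power2_eq_square mult_ac add_divide_distrib distrib_left distrib_right)
qed simp

lemma norm_sqrt_iter_le_norm: "x \<in> X \<Longrightarrow> norm (sqrt_iter K n x) \<le> norm x"
  using norm_sqrt_iter_le[of x n] sqrt_majorant_bounds(2)[of n]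
    mult_right_mono[of "sqrt_majorant n" 1 "norm x"] by simp

text \<open>The increments of the scalar iteration have a telescoping, convergent sum, so this
  domination makes the operator iteration converge at every vector.\<close>

lemma norm_sqrt_iter_diff_le:
  "x \<in> X \<Longrightarrow> norm (sqrt_iter K (Suc n) x - sqrt_iter K n x)
    \<le> (sqrt_majorant (Suc n) - sqrt_majorant n) * norm x"
proof (induction n arbitrary: x)
  case 0
  then show ?case
    using contraction_norm[OF K] by simp
next
  case (Suc n)
  let ?p = "sqrt_iter K (Suc n)" and ?q = "sqrt_iter K n"
    and ?a = "sqrt_majorant (Suc n)" and ?b = "sqrt_majorant n"
  note sub = hilbert_csubspace[OF X]
  have mem: "?p x \<in> X" "?q x \<in> X"
    using Suc.prems sqrt_iter_bop bop_app by blast+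
  \<comment> \<open>The operator form of a^2 - b^2 = a (a - b) + (a - b) b, arranged so that no
    commutation of \<open>?p\<close> and \<open>?q\<close> enters.\<close>
  have "?p (?p x) - ?q (?q x) = ?p (?p x - ?q x) + (?p (?q x) - ?q (?q x))"
    using bop_diff[OF sub sqrt_iter_bop mem, of "Suc n"] by simp
  also have "norm \<dots> \<le> ?a * ((?a - ?b) * norm x) + (?a - ?b) * (?b * norm x)"
  proof (rule norm_triangle_mono)
    have "norm (?p (?p x - ?q x)) \<le> ?a * norm (?p x - ?q x)"
      using mem sub by (intro norm_sqrt_iter_le csubspace_diff)
    also have "\<dots> \<le> ?a * ((?a - ?b) * norm x)"
      using Suc sqrt_majorant_bounds by (intro mult_left_mono) auto
    finally show "norm (?p (?p x - ?q x)) \<le> ?a * ((?a - ?b) * norm x)" .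
    have ge: "0 \<le> ?a - ?b"
      using zero_le_power2[of "1 - ?b"] by (simp add: power2_eq_square algebra_simps)
    have "norm (?p (?q x) - ?q (?q x)) \<le> (?a - ?b) * norm (?q x)"
      using Suc.IH mem by blast
    also have "\<dots> \<le> (?a - ?b) * (?b * norm x)"
      using norm_sqrt_iter_le Suc.prems ge by (intro mult_left_mono) auto
    finally show "norm (?p (?q x) - ?q (?q x)) \<le> (?a - ?b) * (?b * norm x)" .
  qed
  also have "\<dots> = 2 * ((sqrt_majorant (Suc (Suc n)) - sqrt_majorant (Suc n)) * norm x)"
    by (simp add: power2_eq_square field_simps)
  finally have le: "norm (?p (?p x) - ?q (?q x))
    \<le> 2 * ((sqrt_majorant (Suc (Suc n)) - sqrt_majorant (Suc n)) * norm x)" .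
  have "sqrt_iter K (Suc (Suc n)) x - ?p x = (1/2) *\<^sub>R (?p (?p x) - ?q (?q x))"
    by (simp only: sqrt_iter.simps(2)[of K "Suc n"] sqrt_iter.simps(2)[of K n])
      (simp add: algebra_simps)
  then show ?case
    using le by simp
qed

lemma sqrt_iter_tendsto:
  assumes "x \<in> X"
  shows "(\<lambda>n. sqrt_iter K n x) \<longlonglongrightarrow> sqrt_lim K x"
proof -
  obtain L where "sqrt_majorant \<longlonglongrightarrow> L"
    using convergent_sqrt_majorant by (auto simp: convergent_def)
  then have "summable (\<lambda>n. sqrt_majorant (Suc n) - sqrt_majorant n)"
    by (rule telescope_summable)
  then have "summable (\<lambda>n. (sqrt_majorant (Suc n) - sqrt_majorant n) * norm x)"
    by (rule summable_mult2)
  then have "summable (\<lambda>n. sqrt_iter K (Suc n) x - sqrt_iter K n x)"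
    by (rule summable_comparison_test')
      (use norm_sqrt_iter_diff_le[OF assms] in auto)
  then have "convergent (\<lambda>n. \<Sum>i<n. sqrt_iter K (Suc i) x - sqrt_iter K i x)"
    by (simp add: summable_iff_convergent)
  moreover have "(\<lambda>n. \<Sum>i<n. sqrt_iter K (Suc i) x - sqrt_iter K i x) = (\<lambda>n. sqrt_iter K n x)"
    by (rule ext, subst sum_lessThan_telescope) simp
  ultimately show ?thesis
    unfolding sqrt_lim_def by (simp only: convergent_LIMSEQ_iff)
qed

lemma sqrt_lim_mem: "x \<in> X \<Longrightarrow> sqrt_lim K x \<in> X"
  using closed_sequentially[OF hilbert_closed[OF X] _ sqrt_iter_tendsto] sqrt_iter_bop bop_app
  by metis

lemma norm_sqrt_lim_le: "x \<in> X \<Longrightarrow> norm (sqrt_lim K x) \<le> norm x"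
  using norm_sqrt_iter_le_norm
  by (intro LIMSEQ_le_const2[OF tendsto_norm[OF sqrt_iter_tendsto]]) auto

lemma sqrt_lim_bop: "sqrt_lim K \<in> bop X X"
proof (rule bopI[where K = 1])
  note sub = hilbert_csubspace[OF X]
  fix x assume x: "x \<in> X"
  show "sqrt_lim K (c *\<^sub>C x) = c *\<^sub>C sqrt_lim K x" for c
  proof (rule LIMSEQ_unique)
    show "(\<lambda>n. sqrt_iter K n (c *\<^sub>C x)) \<longlonglongrightarrow> sqrt_lim K (c *\<^sub>C x)"
      using x sub by (intro sqrt_iter_tendsto csubspace_scaleC)
    show "(\<lambda>n. sqrt_iter K n (c *\<^sub>C x)) \<longlonglongrightarrow> c *\<^sub>C sqrt_lim K x"
      using x by (simp add: bop_scaleC[OF sqrt_iter_bop] scaleC.tendsto sqrt_iter_tendsto)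
  qed
  fix y assume y: "y \<in> X"
  show "sqrt_lim K (x + y) = sqrt_lim K x + sqrt_lim K y"
  proof (rule LIMSEQ_unique)
    show "(\<lambda>n. sqrt_iter K n (x + y)) \<longlonglongrightarrow> sqrt_lim K (x + y)"
      using x y sub by (intro sqrt_iter_tendsto csubspace_add)
    show "(\<lambda>n. sqrt_iter K n (x + y)) \<longlonglongrightarrow> sqrt_lim K x + sqrt_lim K y"
      using x y by (simp add: bop_add[OF sqrt_iter_bop] tendsto_add sqrt_iter_tendsto)
  qed
qed (use norm_sqrt_lim_le sqrt_lim_mem in auto)

text \<open>Write Y_n for the iterates and y for the limit of Y_n x. In Y_n (Y_n x) = Y_n (Y_n x -
  y) + Y_n y the first term has norm at most ||Y_n x - y||, so the recursion passes to the
  limit.\<close>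

lemma sqrt_lim_equation:
  assumes x: "x \<in> X"
  shows "2 *\<^sub>R sqrt_lim K x = K x + sqrt_lim K (sqrt_lim K x)"
proof -
  note sub = hilbert_csubspace[OF X]
  let ?y = "sqrt_lim K x"
  have "(\<lambda>n. sqrt_iter K n (sqrt_iter K n x - ?y)) \<longlonglongrightarrow> 0"
  proof (rule metric_tendsto_imp_tendsto)
    show "(\<lambda>n. sqrt_iter K n x - ?y) \<longlonglongrightarrow> 0"
      using sqrt_iter_tendsto[OF x] by (simp add: LIM_zero)
    show "\<forall>\<^sub>F n in sequentially. dist (sqrt_iter K n (sqrt_iter K n x - ?y)) 0
        \<le> dist (sqrt_iter K n x - ?y) 0"
      using norm_sqrt_iter_le_norm bop_app[OF sqrt_iter_bop x] sqrt_lim_mem[OF x] sub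
      by (auto intro!: always_eventually simp: csubspace_diff)
  qed
  then have "(\<lambda>n. sqrt_iter K n (sqrt_iter K n x - ?y) + sqrt_iter K n ?y) \<longlonglongrightarrow> 0 + sqrt_lim K ?y"
    using sqrt_iter_tendsto sqrt_lim_mem[OF x] by (intro tendsto_add) auto
  moreover have "sqrt_iter K n (sqrt_iter K n x - ?y) + sqrt_iter K n ?y
      = sqrt_iter K n (sqrt_iter K n x)" for n
    using bop_app[OF sqrt_iter_bop x] sqrt_lim_mem[OF x] sub
    by (simp add: bop_diff[OF _ sqrt_iter_bop])
  ultimately have "(\<lambda>n. K x + sqrt_iter K n (sqrt_iter K n x)) \<longlonglongrightarrow> K x + sqrt_lim K ?y"
    by (simp add: tendsto_add)
  moreover have "(\<lambda>n. K x + sqrt_iter K n (sqrt_iter K n x)) \<longlonglongrightarrow> 2 *\<^sub>R ?y"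
    using tendsto_scaleR[OF tendsto_const LIMSEQ_Suc[OF sqrt_iter_tendsto[OF x]], of 2]
    by simp
  ultimately show ?thesis
    by (rule LIMSEQ_unique[symmetric])
qed

end

text \<open>Every iterate is a polynomial in \<open>K\<close>, so V K = K' V passes to the iterates
  and, \<open>V\<close> being continuous, to their limits. It serves twice: for V a square root
  commuting with K, and for V = T with K = T*T and K' = TT*.\<close>

lemma sqrt_lim_intertwine:
  assumes X: "hilbert X" and K: "contraction X X K"
    and X': "hilbert X'" and K': "contraction X' X' K'"
    and V: "V \<in> bop X X'" and VK: "\<And>x. x \<in> X \<Longrightarrow> V (K x) = K' (V x)"
    and x: "x \<in> X"
  shows "V (sqrt_lim K x) = sqrt_lim K' (V x)"
proof -
  note sub = hilbert_csubspace[OF X]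
  have iter: "V (sqrt_iter K n x) = sqrt_iter K' n (V x)" if "x \<in> X" for n x
    using that
  proof (induction n arbitrary: x)
    case 0
    then show ?case
      using V sub by (simp add: bop_zero)
  next
    case (Suc n)
    have "sqrt_iter K n x \<in> X" "sqrt_iter K n (sqrt_iter K n x) \<in> X" "K x \<in> X"
      using Suc.prems sqrt_iter_bop[OF X K] contraction_bop[OF K] bop_app by blast+
    then show ?case
      using Suc VK V sub by (simp add: bop_scaleR[OF V] bop_add[OF V] csubspace_add)
  qed
  have "continuous_on X V"
    using V sub by (rule bop_continuous_on[rotated])
  then have "(\<lambda>n. V (sqrt_iter K n x)) \<longlonglongrightarrow> V (sqrt_lim K x)"
    by (rule continuous_on_tendsto_compose[OF _ sqrt_iter_tendsto[OF X K x] sqrt_lim_mem[OF X K x]])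
      (use bop_app[OF sqrt_iter_bop[OF X K] x] in auto)
  then show ?thesis
    using sqrt_iter_tendsto[OF X' K' bop_app[OF V x]] x by (simp add: iter LIMSEQ_unique)
qed

text \<open>Polarization: the quadratic form is real at x + y and at i x + y, which gives the
  imaginary and the real part of the identity respectively.\<close>

lemma positive_op_selfadjoint:
  assumes X: "csubspace X" and R: "positive_op X R" and x: "x \<in> X" and y: "y \<in> X"
  shows "cinner (R x) y = cinner x (R y)"
proof -
  have bop: "R \<in> bop X X" and im: "\<And>x. x \<in> X \<Longrightarrow> Im (cinner (R x) x) = 0"
    using R by (auto simp: positive_op_def complex_nonneg_Reals_iff)
  have "cinner (R y) x = cnj (cinner (R x) y)"
  proof (rule complex_eqI)
    show "Im (cinner (R y) x) = Im (cnj (cinner (R x) y))"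
      using im[of "x + y"] im[OF x] im[OF y] x y X
      by (simp add: bop_add[OF bop] csubspace_add cinner_add_left cinner_add_right)
    show "Re (cinner (R y) x) = Re (cnj (cinner (R x) y))"
      using im[of "\<i> *\<^sub>C x + y"] im[OF x] im[OF y] x y X
      by (simp add: bop_add[OF bop] bop_scaleC[OF bop] csubspace_add csubspace_scaleC
          cinner_add_left cinner_add_right cinner_scaleC_left cinner_scaleC_right)
  qed
  then show ?thesis
    by (metis cinner_commute)
qed

text \<open>The nonnegative form attains its minimum 0 at \<open>y\<close>, so its first variation
  in the direction R y, namely 2 ||R y||^2, vanishes.\<close>

lemma positive_op_eq_zero:
  assumes X: "csubspace X" and R: "positive_op X R" and y: "y \<in> X" and "cinner (R y) y = 0"
  shows "R y = 0"
proof -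
  have bop: "R \<in> bop X X" and nonneg: "\<And>x. x \<in> X \<Longrightarrow> 0 \<le> Re (cinner (R x) x)"
    using R by (auto simp: positive_op_def complex_nonneg_Reals_iff)
  let ?w = "R y"
  have w: "?w \<in> X"
    using bop y bop_app by blast
  have "0 \<le> t * (2 * Re (cinner (R y) ?w)) + t\<^sup>2 * Re (cinner (R ?w) ?w)" for t
  proof -
    have "Re (cinner (R ?w) y) = Re (cinner (R y) ?w)"
      using positive_op_selfadjoint[OF X R w y] by simp
    then show ?thesis
      using nonneg[of "y + t *\<^sub>R ?w"] y w X \<open>cinner (R y) y = 0\<close>
      by (simp add: csubspace_add csubspace_scaleR bop_add[OF bop] bop_scaleR[OF bop]
          cinner.add_left cinner.add_right cinner.scaleR_left cinner.scaleR_right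
          power2_eq_square algebra_simps)
  qed
  then have "2 * Re (cinner (R y) ?w) = 0"
    by (rule quadratic_nonneg_imp_linear_zero)
  then show ?thesis
    by (simp add: cinner_self)
qed

text \<open>Self-adjointness of K passes to the iterates and to their limit Y, so <Y x, x> is real;
  since Y is a contraction, it is at most ||x||^2.\<close>

lemma positive_op_id_minus_sqrt_lim:
  assumes X: "hilbert X" and K: "contraction X X K"
    and sa: "\<And>x y. x \<in> X \<Longrightarrow> y \<in> X \<Longrightarrow> cinner (K x) y = cinner x (K y)"
  shows "positive_op X (\<lambda>x. x - sqrt_lim K x)"
proof -
  note sub = hilbert_csubspace[OF X]
  have iter: "cinner (sqrt_iter K n x) y = cinner x (sqrt_iter K n y)"
    if "x \<in> X" "y \<in> X" for n x y
    using that
  proof (induction n arbitrary: x y)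
    case (Suc n)
    then show ?case
      using sa bop_app[OF sqrt_iter_bop[OF X K]]
      by (simp add: cinner.scaleR_left cinner.scaleR_right cinner_add_left cinner_add_right)
  qed (simp add: cinner.zero_left cinner.zero_right)
  have "cinner (sqrt_lim K x) x = cinner x (sqrt_lim K x)" if x: "x \<in> X" for x
  proof (rule LIMSEQ_unique)
    show "(\<lambda>n. cinner (sqrt_iter K n x) x) \<longlonglongrightarrow> cinner (sqrt_lim K x) x"
      by (intro cinner.tendsto sqrt_iter_tendsto[OF X K x] tendsto_const)
    show "(\<lambda>n. cinner (sqrt_iter K n x) x) \<longlonglongrightarrow> cinner x (sqrt_lim K x)"
      using x by (simp add: iter cinner.tendsto sqrt_iter_tendsto[OF X K x])
  qed
  then have im: "Im (cinner (sqrt_lim K x) x) = 0" if "x \<in> X" for x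
    using that arg_cong[OF cinner_commute[of x "sqrt_lim K x"], of Im] by simp
  have "cinner (x - sqrt_lim K x) x \<in> \<real>\<^sub>\<ge>\<^sub>0" if x: "x \<in> X" for x
  proof -
    have "Re (cinner (sqrt_lim K x) x) \<le> norm (sqrt_lim K x) * norm x"
      using norm_cinner_le complex_Re_le_cmod order_trans by blast
    also have "\<dots> \<le> norm x * norm x"
      using norm_sqrt_lim_le[OF X K x] by (intro mult_right_mono) auto
    finally show ?thesis
      using im[OF x] by (simp add: complex_nonneg_Reals_iff cinner.diff_left cinner_self
          power2_eq_square)
  qed
  then show ?thesis
    using sub sqrt_lim_bop[OF X K] by (simp add: positive_op_def bop_minus_fun bop_id)
qed

text \<open>The chosen root \<open>R\<close> commutes with the root \<open>Q = I - sqrt_lim K\<close>, so \<open>y = (R - Q) x\<close> satisfies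
  \<open>\<langle>R y, y\<rangle> + \<langle>Q y, y\<rangle> = \<langle>(R\<^sup>2 - Q\<^sup>2) x, y\<rangle> = 0\<close>.\<close>

lemma op_sqrt_eq:
  assumes X: "hilbert X" and K: "contraction X X K"
    and sa: "\<And>x y. x \<in> X \<Longrightarrow> y \<in> X \<Longrightarrow> cinner (K x) y = cinner x (K y)"
  shows "x \<in> X \<Longrightarrow> op_sqrt X (\<lambda>x. x - K x) x = x - sqrt_lim K x"
    and "positive_op X (op_sqrt X (\<lambda>x. x - K x))"
    and "x \<in> X \<Longrightarrow> op_sqrt X (\<lambda>x. x - K x) (op_sqrt X (\<lambda>x. x - K x) x) = x - K x"
proof -
  note sub = hilbert_csubspace[OF X]
  define Q where "Q x = x - sqrt_lim K x" for x
  define R where "R = op_sqrt X (\<lambda>x. x - K x)"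
  have Q: "positive_op X Q"
    unfolding Q_def by (rule positive_op_id_minus_sqrt_lim[OF X K sa])
  have Q2: "Q (Q x) = x - K x" if "x \<in> X" for x
  proof -
    have "Q (Q x) = x - 2 *\<^sub>R sqrt_lim K x + sqrt_lim K (sqrt_lim K x)"
      using that sqrt_lim_mem[OF X K]
      by (simp add: Q_def bop_diff[OF sub sqrt_lim_bop[OF X K]] scaleR_2)
    then show ?thesis
      using sqrt_lim_equation[OF X K that] by simp
  qed
  have "positive_op X R \<and> (\<forall>x\<in>X. R (R x) = x - K x)"
    unfolding R_def op_sqrt_def by (rule someI[of _ Q]) (use Q Q2 in auto)
  then have R: "positive_op X R" and R2: "\<And>x. x \<in> X \<Longrightarrow> R (R x) = x - K x"
    by auto
  have Rb: "R \<in> bop X X" and Qb: "Q \<in> bop X X"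
    using R Q by (auto simp: positive_op_def)
  \<comment> \<open>K = I - R^2 on \<open>X\<close>, so R commutes with K; by intertwining it then
    commutes with Q.\<close>
  have RK: "R (K x) = K (R x)" if "x \<in> X" for x
  proof -
    have mem: "R x \<in> X" "K x \<in> X"
      using that Rb contraction_bop[OF K] bop_app by blast+
    have "K x = x - R (R x)"
      using R2[OF that] by simp
    then have "R (K x) = R x - R (R (R x))"
      using that mem bop_app[OF Rb] by (simp add: bop_diff[OF sub Rb])
    then show ?thesis
      using R2[OF mem(1)] by simp
  qed
  have RQ: "R (Q x) = Q (R x)" if "x \<in> X" for x
    using sqrt_lim_intertwine[OF X K X K Rb RK that] that sqrt_lim_mem[OF X K that]
    by (simp add: Q_def bop_diff[OF sub Rb])
  have "R x = Q x" if x: "x \<in> X" for x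
  proof -
    let ?y = "R x - Q x"
    have mem: "R x \<in> X" "Q x \<in> X" "?y \<in> X"
      using x by (auto intro!: csubspace_diff[OF sub] bop_app[OF Rb] bop_app[OF Qb])
    have "R ?y + Q ?y = 0"
      using mem x by (simp add: bop_diff[OF sub Rb] bop_diff[OF sub Qb] R2 Q2 RQ)
    then have sum: "cinner (R ?y) ?y + cinner (Q ?y) ?y = 0"
      by (metis cinner.add_left cinner.zero_left)
    moreover have "cinner (R ?y) ?y \<in> \<real>\<^sub>\<ge>\<^sub>0" "cinner (Q ?y) ?y \<in> \<real>\<^sub>\<ge>\<^sub>0"
      using R Q mem(3) by (auto simp: positive_op_def)
    ultimately have "cinner (R ?y) ?y = 0" "cinner (Q ?y) ?y = 0"
      by (auto simp: complex_nonneg_Reals_iff complex_eq_iff)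
    then have "R ?y = 0" "Q ?y = 0"
      using positive_op_eq_zero[OF sub] R Q mem(3) by blast+
    \<comment> \<open>By self-adjointness <(R - Q) x, y> = <x, R y - Q y>, and both terms on the
      right vanish.\<close>
    then have "cinner ?y ?y = 0"
      using positive_op_selfadjoint[OF sub R x mem(3)] positive_op_selfadjoint[OF sub Q x mem(3)]
      by (simp add: cinner.diff_left cinner.zero_right)
    then show ?thesis
      by (simp add: cinner_self)
  qed
  then show "x \<in> X \<Longrightarrow> op_sqrt X (\<lambda>x. x - K x) x = x - sqrt_lim K x"
    and "positive_op X (op_sqrt X (\<lambda>x. x - K x))"
    and "x \<in> X \<Longrightarrow> op_sqrt X (\<lambda>x. x - K x) (op_sqrt X (\<lambda>x. x - K x) x) = x - K x"
    using R R2 by (simp_all add: R_def Q_def)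
qed

section \<open>Defect operators of contractions\<close>

context
  fixes X :: "'a::chilbert set" and Y :: "'b::chilbert set" and T :: "'a \<Rightarrow> 'b"
  assumes X: "hilbert X" and Y: "hilbert Y" and T: "contraction X Y T"
begin

lemma contraction_adj_comp: "contraction X X (\<lambda>x. adj X T (T x))"
proof -
  have adj: "contraction Y X (adj X T)"
    using contraction_adj[OF X T] .
  have "norm (adj X T (T x)) \<le> norm x" if "x \<in> X" for x
    using contraction_norm[OF adj, of "T x"] contraction_norm[OF T that]
      bop_app[OF contraction_bop[OF T] that] by linarith
  then show ?thesis
    using bop_compose[OF contraction_bop[OF adj] contraction_bop[OF T]]
    by (simp add: contraction_def)
qed

lemma adj_comp_selfadjoint:
  assumes "x \<in> X" "y \<in> X"
  shows "cinner (adj X T (T x)) y = cinner x (adj X T (T y))"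
  by (simp only: cinner_adj_left[OF X contraction_bop[OF T] assms(2)]
      cinner_adj[OF X contraction_bop[OF T] assms(1), symmetric])

lemma defect_eq: "x \<in> X \<Longrightarrow> defect X T x = x - sqrt_lim (\<lambda>x. adj X T (T x)) x"
  and positive_op_defect: "positive_op X (defect X T)"
  and defect_defect: "x \<in> X \<Longrightarrow> defect X T (defect X T x) = x - adj X T (T x)"
proof -
  note root = op_sqrt_eq[where K = "\<lambda>x. adj X T (T x)", OF X contraction_adj_comp]
  show "positive_op X (defect X T)"
    unfolding defect_def by (rule root(2)) (rule adj_comp_selfadjoint)
  show "defect X T x = x - sqrt_lim (\<lambda>x. adj X T (T x)) x" if "x \<in> X"
    unfolding defect_def by (rule root(1)[OF _ that]) (rule adj_comp_selfadjoint)
  show "defect X T (defect X T x) = x - adj X T (T x)" if "x \<in> X"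
    unfolding defect_def by (rule root(3)[OF _ that]) (rule adj_comp_selfadjoint)
qed

lemma defect_bop: "defect X T \<in> bop X X"
  using positive_op_defect by (simp add: positive_op_def)

lemma defect_selfadjoint: "x \<in> X \<Longrightarrow> y \<in> X \<Longrightarrow> cinner (defect X T x) y = cinner x (defect X T y)"
  using positive_op_selfadjoint[OF hilbert_csubspace[OF X] positive_op_defect] .

lemma hilbert_defect_space: "hilbert (defect_space X T)"
  unfolding defect_space_def
  by (rule hilbert_closure[OF bop_image_csubspace[OF hilbert_csubspace[OF X] defect_bop]])

lemma defect_mem_space: "x \<in> X \<Longrightarrow> defect X T x \<in> defect_space X T"
  unfolding defect_space_def by (intro subsetD[OF closure_subset] imageI)

lemma defect_space_subset: "defect_space X T \<subseteq> X"
  unfolding defect_space_def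
  using bop_app[OF defect_bop] hilbert_closed[OF X] by (intro closure_minimal image_subsetI)

lemma defect_bop_space: "defect X T \<in> bop X (defect_space X T)"
  using bop_codomain[OF defect_bop defect_mem_space] .

lemma adj_adj_contraction: "x \<in> X \<Longrightarrow> adj Y (adj X T) x = T x"
  using adj_adj[OF X hilbert_csubspace[OF Y] contraction_bop[OF T]] .

text \<open>T intertwines T*T with TT*, hence also the square roots of I - T*T and I - TT*.\<close>

lemma defect_intertwine:
  assumes x: "x \<in> X"
  shows "T (defect X T x) = defect Y (adj X T) (T x)"
proof -
  note Tb = contraction_bop[OF T]
  have adj: "contraction Y X (adj X T)"
    using contraction_adj[OF X T] .
  \<comment> \<open>This is TT* in the form to which the defect operator of the adjoint unfolds; the
    double adjoint agrees with T on \<open>X\<close>.\<close>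
  let ?K' = "\<lambda>y. adj Y (adj X T) (adj X T y)"
  have K': "contraction Y Y ?K'"
  proof -
    have "contraction X Y (adj Y (adj X T))"
      by (rule contraction_adj[OF Y adj])
    moreover have "norm (?K' y) \<le> norm y" if "y \<in> Y" for y
      using contraction_norm[OF adj that] contraction_norm[OF calculation, of "adj X T y"]
        bop_app[OF contraction_bop[OF adj] that] by linarith
    ultimately show ?thesis
      using bop_compose[OF contraction_bop contraction_bop[OF adj]] by (simp add: contraction_def)
  qed
  have "T (sqrt_lim (\<lambda>x. adj X T (T x)) x) = sqrt_lim ?K' (T x)"
    by (rule sqrt_lim_intertwine[OF X contraction_adj_comp Y K' Tb _ x])
      (simp add: adj_adj_contraction adj_mem[OF X Tb])
  moreover have "defect Y (adj X T) (T x) = T x - sqrt_lim ?K' (T x)"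
    unfolding defect_def
  proof (rule op_sqrt_eq(1)[OF Y K' _ bop_app[OF Tb x]])
    show "cinner (?K' u) v = cinner u (?K' v)" if "u \<in> Y" "v \<in> Y" for u v
      by (simp only: cinner_adj_left[OF Y contraction_bop[OF adj] that(2)]
          cinner_adj[OF Y contraction_bop[OF adj] that(1), symmetric])
  qed
  ultimately show ?thesis
    using x sqrt_lim_mem[OF X contraction_adj_comp x]
    by (simp add: defect_eq bop_diff[OF hilbert_csubspace[OF X] Tb])
qed

end

text \<open><D_T x, D_T x> = <x, D_T^2 x> = <x, x - T*T x>: the defect operator measures the energy
  that T loses.\<close>

lemma norm_defect:
  assumes X: "hilbert X" and Y: "hilbert Y" and T: "contraction X Y T" and x: "x \<in> X"
  shows "(norm (defect X T x))\<^sup>2 = (norm x)\<^sup>2 - (norm (T x))\<^sup>2"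
proof -
  have "cinner (defect X T x) (defect X T x) = cinner x (x - adj X T (T x))"
    using defect_selfadjoint[OF X Y T x bop_app[OF defect_bop[OF X Y T] x]]
      defect_defect[OF X Y T x] by simp
  also have "\<dots> = cinner x x - cinner (T x) (T x)"
    using cinner_adj[OF X contraction_bop[OF T] x] by (simp add: cinner.diff_right)
  finally have "Re (of_real ((norm (defect X T x))\<^sup>2))
      = Re (of_real ((norm x)\<^sup>2) - of_real ((norm (T x))\<^sup>2))"
    by (simp only: cinner_self)
  then show ?thesis
    by simp
qed

text \<open>The kernel of the self-adjoint D_T is orthogonal to its range, hence to the closure of
  the range, which is the defect space.\<close>

lemma defect_eq_zero_iff:
  assumes X: "hilbert X" and Y: "hilbert Y" and T: "contraction X Y T"
    and y: "y \<in> defect_space X T"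
  shows "defect X T y = 0 \<longleftrightarrow> y = 0"
proof
  assume 0: "defect X T y = 0"
  have "y \<in> X"
    using y defect_space_subset[OF X Y T] by blast
  obtain f where f: "\<And>n. f n \<in> defect X T ` X" "f \<longlonglongrightarrow> y"
    using y unfolding defect_space_def closure_sequential by blast
  have "cinner (f n) y = 0" for n
    using f(1)[of n] defect_selfadjoint[OF X Y T _ \<open>y \<in> X\<close>] 0 by (auto simp: cinner.zero_right)
  moreover have "(\<lambda>n. cinner (f n) y) \<longlonglongrightarrow> cinner y y"
    by (intro cinner.tendsto f tendsto_const)
  ultimately have "cinner y y = 0"
    by (simp add: LIMSEQ_const_iff)
  then show "y = 0"
    by (simp add: cinner_self)
qed (use bop_zero[OF hilbert_csubspace[OF X] defect_bop[OF X Y T]] in simp)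


section \<open>Resolvents and transfer functions\<close>

definition resolvent :: "'a::chilbert set \<Rightarrow> ('a \<Rightarrow> 'a) \<Rightarrow> complex \<Rightarrow> 'a \<Rightarrow> 'a"
  where "resolvent H A z = inv_into H (\<lambda>h. h - z *\<^sub>C A h)"

text \<open>Solving h - zA h = v means finding a fixed point of h \<mapsto> v + zA h, a strict
  contraction of the complete set \<open>H\<close>. Existence gives surjectivity, uniqueness gives
  injectivity.\<close>

lemma bij_betw_id_minus_scaleC:
  assumes H: "hilbert H" and A: "A \<in> bop H H"
    and K: "\<And>h. h \<in> H \<Longrightarrow> norm (A h) \<le> K * norm h" "K \<ge> 0" and z: "cmod z * K < 1"
  shows "bij_betw (\<lambda>h. h - z *\<^sub>C A h) H H"
proof -
  note sub = hilbert_csubspace[OF H]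
  have ex1: "\<exists>!h. h \<in> H \<and> v + z *\<^sub>C A h = h" if v: "v \<in> H" for v
  proof (rule Banach_fix)
    show "complete H"
      using hilbert_closed[OF H] by (simp add: complete_eq_closed)
    show "H \<noteq> {}"
      using csubspace_zero[OF sub] by auto
    show "(\<lambda>h. v + z *\<^sub>C A h) ` H \<subseteq> H"
      using v sub bop_app[OF A] by (auto intro!: csubspace_intros)
    show "dist (v + z *\<^sub>C A x) (v + z *\<^sub>C A y) \<le> cmod z * K * dist x y"
      if "x \<in> H" "y \<in> H" for x y
    proof -
      have "dist (v + z *\<^sub>C A x) (v + z *\<^sub>C A y) = norm (z *\<^sub>C A (x - y))"
        using that by (simp add: dist_norm scaleC.diff_right bop_diff[OF sub A])
      also have "\<dots> \<le> cmod z * (K * norm (x - y))"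
        unfolding norm_scaleC
        using K(1) that sub by (intro mult_left_mono) (auto simp: csubspace_diff)
      finally show "dist (v + z *\<^sub>C A x) (v + z *\<^sub>C A y) \<le> cmod z * K * dist x y"
        by (simp add: dist_norm mult_ac)
    qed
  qed (use K z in auto)
  show ?thesis
    unfolding bij_betw_def
  proof (intro conjI inj_onI equalityI subsetI)
    fix x y assume *: "x \<in> H" "y \<in> H" "x - z *\<^sub>C A x = y - z *\<^sub>C A y"
    then have "x - z *\<^sub>C A x \<in> H"
      using sub bop_app[OF A] by (intro csubspace_intros)
    moreover have "(x - z *\<^sub>C A x) + z *\<^sub>C A x = x"
      by simp
    moreover have "(x - z *\<^sub>C A x) + z *\<^sub>C A y = y"
      unfolding *(3) by simp
    ultimately show "x = y"
      using ex1 * by blast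
  next
    fix v assume "v \<in> (\<lambda>h. h - z *\<^sub>C A h) ` H"
    then show "v \<in> H"
      using sub bop_app[OF A] by (auto intro!: csubspace_intros)
  next
    fix v assume "v \<in> H"
    then obtain h where "h \<in> H" "v + z *\<^sub>C A h = h"
      using ex1 by blast
    then show "v \<in> (\<lambda>h. h - z *\<^sub>C A h) ` H"
      by (auto intro!: image_eqI[of _ _ h] simp: algebra_simps)
  qed
qed

lemma eventually_bij_betw_id_minus_scaleC:
  assumes H: "hilbert H" and A: "A \<in> bop H H"
  shows "\<forall>\<^sub>F z in nhds 0. bij_betw (\<lambda>h. h - z *\<^sub>C A h) H H"
proof -
  obtain K where K: "K \<ge> 0" "\<And>x. x \<in> H \<Longrightarrow> norm (A x) \<le> K * norm x"
    using bop_bound[OF A] by blast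
  have "((\<lambda>z. cmod z * K) \<longlongrightarrow> cmod 0 * K) (nhds 0)"
    by (intro tendsto_intros filterlim_ident)
  then have "\<forall>\<^sub>F z in nhds 0. cmod z * K < 1"
    by (rule order_tendstoD) simp
  then show ?thesis
    by (rule eventually_mono) (rule bij_betw_id_minus_scaleC[OF H A K(2,1)])
qed

lemma resolvent_mem:
  "bij_betw (\<lambda>h. h - z *\<^sub>C A h) H H \<Longrightarrow> v \<in> H \<Longrightarrow> resolvent H A z v \<in> H"
  and resolvent_right:
  "bij_betw (\<lambda>h. h - z *\<^sub>C A h) H H \<Longrightarrow> v \<in> H
    \<Longrightarrow> resolvent H A z v - z *\<^sub>C A (resolvent H A z v) = v"
  and resolvent_eqI:
  "bij_betw (\<lambda>h. h - z *\<^sub>C A h) H H \<Longrightarrow> h \<in> H \<Longrightarrow> h - z *\<^sub>C A h = v \<Longrightarrow> resolvent H A z v = h"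
  unfolding resolvent_def bij_betw_def
  by (auto intro: inv_into_into inv_into_f_eq f_inv_into_f[of v "\<lambda>h. h - z *\<^sub>C A h" H])

text \<open>For contractive \<open>A\<close> the resolvent exists on the whole open disk, and h = v
  + zA h yields (1 - |z|) ||h|| \<le> ||v||.\<close>

lemma resolvent_norm_bop:
  assumes H: "hilbert H" and A: "contraction H H A" and z: "cmod z < 1"
  shows "v \<in> H \<Longrightarrow> norm (resolvent H A z v) \<le> 1 / (1 - cmod z) * norm v"
    and "resolvent H A z \<in> bop H H"
    and "bij_betw (\<lambda>h. h - z *\<^sub>C A h) H H"
proof -
  note sub = hilbert_csubspace[OF H] and Ab = contraction_bop[OF A]
  show bij: "bij_betw (\<lambda>h. h - z *\<^sub>C A h) H H"
    by (rule bij_betw_id_minus_scaleC[OF H Ab, of 1])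
      (use contraction_norm[OF A] z in auto)
  note mem = resolvent_mem[OF bij] and right = resolvent_right[OF bij] and eqI = resolvent_eqI[OF bij]
  show le: "norm (resolvent H A z v) \<le> 1 / (1 - cmod z) * norm v" if "v \<in> H" for v
  proof -
    let ?h = "resolvent H A z v"
    have "norm ?h = norm (v + z *\<^sub>C A ?h)"
      using right[OF that] by (metis diff_add_cancel)
    also have "\<dots> \<le> norm v + cmod z * norm (A ?h)"
      using norm_triangle_ineq by (metis norm_scaleC)
    also have "\<dots> \<le> norm v + cmod z * norm ?h"
      using contraction_norm[OF A mem[OF that]] by (intro add_left_mono mult_left_mono) auto
    finally show ?thesis
      using z by (simp add: field_simps)
  qed
  show "resolvent H A z \<in> bop H H"
  proof (rule bopI)
    fix x y assume xy: "x \<in> H" "y \<in> H"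
    let ?p = "resolvent H A z x" and ?q = "resolvent H A z y"
    have "?p + ?q - z *\<^sub>C A (?p + ?q) = (?p - z *\<^sub>C A ?p) + (?q - z *\<^sub>C A ?q)"
      using mem xy by (simp add: bop_add[OF Ab] scaleC_add_right)
    then have "?p + ?q - z *\<^sub>C A (?p + ?q) = x + y"
      using right xy by simp
    then show "resolvent H A z (x + y) = ?p + ?q"
      using mem xy sub by (intro eqI csubspace_add)
  next
    fix c x assume x: "x \<in> H"
    let ?p = "resolvent H A z x"
    have "c *\<^sub>C ?p - z *\<^sub>C A (c *\<^sub>C ?p) = c *\<^sub>C (?p - z *\<^sub>C A ?p)"
      using mem x by (simp add: bop_scaleC[OF Ab] scaleC.diff_right scaleC_scaleC mult.commute)
    then have "c *\<^sub>C ?p - z *\<^sub>C A (c *\<^sub>C ?p) = c *\<^sub>C x"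
      using right x by simp
    then show "resolvent H A z (c *\<^sub>C x) = c *\<^sub>C ?p"
      using mem x sub by (intro eqI csubspace_scaleC)
  next
    show "norm (resolvent H A z v) \<le> 1 / (1 - cmod z) * norm v" if "v \<in> H" for v
      by (rule le[OF that])
  qed (rule mem)
qed

text \<open>The second identity is adapted to transfer functions, where the resolvent R_z carries
  the factor z: dividing by w - z shows that z R_z has derivative R_z^2, and the first identity
  controls the remainder through R_w - R_z.\<close>

lemma resolvent_identities:
  assumes H: "hilbert H" and A: "A \<in> bop H H"
    and bijw: "bij_betw (\<lambda>h. h - w *\<^sub>C A h) H H"
    and bijz: "bij_betw (\<lambda>h. h - z *\<^sub>C A h) H H" and v: "v \<in> H"
  shows "resolvent H A w v - resolvent H A z v = resolvent H A w ((w - z) *\<^sub>C A (resolvent H A z v))"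
    and "w *\<^sub>C resolvent H A w v - z *\<^sub>C resolvent H A z v
      = resolvent H A w ((w - z) *\<^sub>C resolvent H A z v)"
proof -
  note sub = hilbert_csubspace[OF H]
  let ?x = "resolvent H A w v" and ?y = "resolvent H A z v"
  have mem: "?x \<in> H" "?y \<in> H"
    using resolvent_mem bijw bijz v by blast+
  have x: "?x = v + w *\<^sub>C A ?x" and y: "?y = v + z *\<^sub>C A ?y"
    using resolvent_right[OF bijw v] resolvent_right[OF bijz v] by (metis diff_add_cancel)+
  show "?x - ?y = resolvent H A w ((w - z) *\<^sub>C A ?y)"
  proof (rule resolvent_eqI[OF bijw, symmetric])
    show "?x - ?y \<in> H"
      using mem sub by (simp add: csubspace_diff)
    have "?x - ?y - w *\<^sub>C A (?x - ?y) = (?x - w *\<^sub>C A ?x) - (?y - w *\<^sub>C A ?y)"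
      using mem by (simp add: bop_diff[OF sub A] scaleC.diff_right algebra_simps)
    also have "\<dots> = v - (v + z *\<^sub>C A ?y - w *\<^sub>C A ?y)"
      using x y by (metis add_diff_cancel_right')
    finally show "?x - ?y - w *\<^sub>C A (?x - ?y) = (w - z) *\<^sub>C A ?y"
      by (simp add: scaleC.diff_left)
  qed
  show "w *\<^sub>C ?x - z *\<^sub>C ?y = resolvent H A w ((w - z) *\<^sub>C ?y)"
  proof (rule resolvent_eqI[OF bijw, symmetric])
    show "w *\<^sub>C ?x - z *\<^sub>C ?y \<in> H"
      using mem sub by (simp add: csubspace_intros)
    have "w *\<^sub>C ?x - z *\<^sub>C ?y - w *\<^sub>C A (w *\<^sub>C ?x - z *\<^sub>C ?y)
        = w *\<^sub>C (?x - w *\<^sub>C A ?x) - z *\<^sub>C ?y + w *\<^sub>C z *\<^sub>C A ?y"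
      using mem sub by (simp add: bop_diff[OF sub A] bop_scaleC[OF A] csubspace_scaleC
          scaleC.diff_right algebra_simps)
    also have "\<dots> = w *\<^sub>C v - z *\<^sub>C ?y + w *\<^sub>C (z *\<^sub>C A ?y)"
      using resolvent_right[OF bijw v] by simp
    also have "\<dots> = w *\<^sub>C (v + z *\<^sub>C A ?y) - z *\<^sub>C ?y"
      by (simp add: scaleC_add_right)
    finally show "w *\<^sub>C ?x - z *\<^sub>C ?y - w *\<^sub>C A (w *\<^sub>C ?x - z *\<^sub>C ?y) = (w - z) *\<^sub>C ?y"
      using y by (simp add: scaleC.diff_left)
  qed
qed

section \<open>Transfer functions of passive systems belong to the Schur class\<close>

lemma transfer_function_resolvent:
  "transfer_function \<tau> z m = opD \<tau> m + z *\<^sub>C opC \<tau> (resolvent (stsp \<tau>) (opA \<tau>) z (opB \<tau> m))"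
  by (simp add: transfer_function_def resolvent_def)

lemma norm_Pair_power2: "(norm (x, y))\<^sup>2 = (norm x)\<^sup>2 + (norm y)\<^sup>2"
  by (simp add: norm_Pair)

lemma le_if_sum_power2_le:
  fixes a b c :: real
  assumes "a\<^sup>2 + b\<^sup>2 \<le> c\<^sup>2" "0 \<le> c"
  shows "a \<le> c" and "b \<le> c"
  using assms by (smt (verit) power2_le_imp_le zero_le_power2)+

lemma passive_system_norm_le:
  assumes "passive_system \<tau>" and "h \<in> stsp \<tau>" "m \<in> insp \<tau>"
  shows "(norm (opA \<tau> h + opB \<tau> m))\<^sup>2 + (norm (opC \<tau> h + opD \<tau> m))\<^sup>2 \<le> (norm h)\<^sup>2 + (norm m)\<^sup>2"
proof -
  have "(norm (block_op \<tau> (h, m)))\<^sup>2 \<le> (norm (h, m))\<^sup>2"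
    using assms by (intro power_mono) (auto simp: passive_system_def contraction_def)
  then show ?thesis
    by (simp add: block_op_def norm_Pair_power2)
qed

lemma passive_system_contraction:
  assumes "passive_system \<tau>"
  shows "contraction (stsp \<tau>) (stsp \<tau>) (opA \<tau>)"
    and "contraction (insp \<tau>) (stsp \<tau>) (opB \<tau>)"
    and "contraction (stsp \<tau>) (outsp \<tau>) (opC \<tau>)"
    and "contraction (insp \<tau>) (outsp \<tau>) (opD \<tau>)"
proof -
  have lin: "csubspace (stsp \<tau>)" "csubspace (insp \<tau>)" "opA \<tau> \<in> bop (stsp \<tau>) (stsp \<tau>)"
    "opB \<tau> \<in> bop (insp \<tau>) (stsp \<tau>)" "opC \<tau> \<in> bop (stsp \<tau>) (outsp \<tau>)"
    "opD \<tau> \<in> bop (insp \<tau>) (outsp \<tau>)"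
    using assms by (simp_all add: passive_system_def linear_system_def hilbert_csubspace)
  have zero: "0 \<in> stsp \<tau>" "0 \<in> insp \<tau>" "opA \<tau> 0 = 0" "opB \<tau> 0 = 0" "opC \<tau> 0 = 0" "opD \<tau> 0 = 0"
    by (fact csubspace_zero[OF lin(1)] csubspace_zero[OF lin(2)] bop_zero[OF lin(1,3)]
        bop_zero[OF lin(2,4)] bop_zero[OF lin(1,5)] bop_zero[OF lin(2,6)])+
  have "norm (opA \<tau> h) \<le> norm h" and "norm (opC \<tau> h) \<le> norm h" if "h \<in> stsp \<tau>" for h
  proof -
    have "(norm (opA \<tau> h))\<^sup>2 + (norm (opC \<tau> h))\<^sup>2 \<le> (norm h)\<^sup>2"
      using passive_system_norm_le[OF assms that zero(2)] zero by simp
    then show "norm (opA \<tau> h) \<le> norm h" "norm (opC \<tau> h) \<le> norm h"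
      by (rule le_if_sum_power2_le[OF _ norm_ge_zero])+
  qed
  moreover have "norm (opB \<tau> m) \<le> norm m" and "norm (opD \<tau> m) \<le> norm m" if "m \<in> insp \<tau>" for m
  proof -
    have "(norm (opB \<tau> m))\<^sup>2 + (norm (opD \<tau> m))\<^sup>2 \<le> (norm m)\<^sup>2"
      using passive_system_norm_le[OF assms zero(1) that] zero by simp
    then show "norm (opB \<tau> m) \<le> norm m" "norm (opD \<tau> m) \<le> norm m"
      by (rule le_if_sum_power2_le[OF _ norm_ge_zero])+
  qed
  ultimately show "contraction (stsp \<tau>) (stsp \<tau>) (opA \<tau>)"
    "contraction (insp \<tau>) (stsp \<tau>) (opB \<tau>)" "contraction (stsp \<tau>) (outsp \<tau>) (opC \<tau>)"
    "contraction (insp \<tau>) (outsp \<tau>) (opD \<tau>)"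
    using lin by (simp_all add: contraction_def)
qed

text \<open>With h = (I - zA)^{-1} B m the block operator sends (z h, m) to (h, \<Theta>(z) m), and
  |z| < 1 turns its contractivity into ||\<Theta>(z) m|| \<le> ||m||. The derivative C (I - zA)^{-2}
  B comes from the resolvent identities.\<close>

lemma transfer_function_schur_class:
  assumes "passive_system \<tau>"
  shows "transfer_function \<tau> \<in> schur_class (insp \<tau>) (outsp \<tau>)"
proof -
  obtain A B C D H M N where \<tau>: "\<tau> = System A B C D H M N"
    by (cases \<tau>)
  have lin: "hilbert H" "hilbert M" "hilbert N" "A \<in> bop H H" "B \<in> bop M H" "C \<in> bop H N"
    "D \<in> bop M N"
    using assms by (simp_all add: passive_system_def linear_system_def \<tau>)
  note subH = hilbert_csubspace[OF lin(1)]
    and subN = hilbert_csubspace[OF lin(3)]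
  have T_le: "(norm (A h + B m))\<^sup>2 + (norm (C h + D m))\<^sup>2 \<le> (norm h)\<^sup>2 + (norm m)\<^sup>2"
    if "h \<in> H" "m \<in> M" for h m
    using passive_system_norm_le[OF assms] that by (simp add: \<tau>)
  have A: "contraction H H A"
    using passive_system_contraction(1)[OF assms] by (simp add: \<tau>)
  have B: "norm (B m) \<le> norm m" if "m \<in> M" for m
    using passive_system_contraction(2)[OF assms] that by (simp add: \<tau> contraction_def)
  have C: "norm (C h) \<le> norm h" if "h \<in> H" for h
    using passive_system_contraction(3)[OF assms] that by (simp add: \<tau> contraction_def)
  let ?R = "resolvent H A"
  note R_le = resolvent_norm_bop(1)[OF lin(1) A] and Rb = resolvent_norm_bop(2)[OF lin(1) A]
    and bij = resolvent_norm_bop(3)[OF lin(1) A]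
  have tf: "transfer_function \<tau> z m = D m + z *\<^sub>C C (?R z (B m))" for z m
    by (simp add: transfer_function_resolvent \<tau>)
  have contr: "contraction M N (transfer_function \<tau> z)" if z: "cmod z < 1" for z
    unfolding contraction_def
  proof (intro conjI ballI)
    have "(\<lambda>m. D m + z *\<^sub>C C (?R z (B m))) \<in> bop M N"
      by (intro bop_plus bop_scaleC_fun bop_compose[OF lin(6)] bop_compose[OF Rb[OF z]] lin subN)
    then show "transfer_function \<tau> z \<in> bop M N"
      by (simp add: tf[abs_def])
    fix m assume m: "m \<in> M"
    let ?h = "?R z (B m)"
    have h: "?h \<in> H"
      using bop_app[OF Rb[OF z] bop_app[OF lin(5) m]] .
    have "A (z *\<^sub>C ?h) + B m = ?h"
      using resolvent_right[OF bij[OF z] bop_app[OF lin(5) m]] h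
      by (simp add: bop_scaleC[OF lin(4)] algebra_simps)
    moreover have "C (z *\<^sub>C ?h) + D m = transfer_function \<tau> z m"
      using h by (simp add: tf bop_scaleC[OF lin(6)] add.commute)
    ultimately have "(norm ?h)\<^sup>2 + (norm (transfer_function \<tau> z m))\<^sup>2
        \<le> (cmod z * norm ?h)\<^sup>2 + (norm m)\<^sup>2"
      using T_le[OF csubspace_scaleC[OF subH h] m, of z] by (simp add: norm_scaleC)
    moreover have "(cmod z * norm ?h)\<^sup>2 \<le> (norm ?h)\<^sup>2"
      using z by (intro power_mono) (auto simp: mult_left_le_one_le)
    ultimately have "(norm (transfer_function \<tau> z m))\<^sup>2 \<le> (norm m)\<^sup>2"
      by linarith
    then show "norm (transfer_function \<tau> z m) \<le> norm m"
      by (rule power2_le_imp_le) simp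
  qed
  have "op_holomorphic_on M N (transfer_function \<tau>) (ball 0 1)"
    unfolding op_holomorphic_on_def
  proof (intro ballI)
    fix z :: complex assume "z \<in> ball 0 1"
    then have z: "cmod z < 1" by simp
    define d where "d = 1 - cmod z"
    have d: "d > 0" using z by (simp add: d_def)
    define T where "T m = C (?R z (?R z (B m)))" for m
    have Tb: "T \<in> bop M N"
      unfolding T_def by (intro bop_compose[OF lin(6)] bop_compose[OF Rb[OF z]] lin)
    \<comment> \<open>The remainder is (w - z)^2 C R_w A R_z R_z B m. Each R_z costs a factor 1/d;
      |w - z| < d/2 keeps 1 - |w| at least d/2, so R_w costs 2/d. Hence the constant 2/d^3.\<close>
    have est: "norm (transfer_function \<tau> w m - transfer_function \<tau> z m - (w - z) *\<^sub>C T m)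
        \<le> (2 / d ^ 3 * cmod (w - z)) * cmod (w - z) * norm m"
      if m: "m \<in> M" and w: "cmod (w - z) < d / 2" for w m
    proof -
      let ?b = "B m" and ?c = "?R z (B m)"
      have dw: "d / 2 \<le> 1 - cmod w"
        using w norm_triangle_ineq2[of w z] by (simp add: d_def)
      then have w1: "cmod w < 1"
        using d by linarith
      have b: "?b \<in> H" and c: "?c \<in> H" and cw: "?R w ?b \<in> H" and cz: "?R z ?c \<in> H"
        and cwz: "?R w ?c \<in> H"
        using m bop_app[OF lin(5)] bop_app[OF Rb[OF z]] bop_app[OF Rb[OF w1]] by auto
      let ?e = "?R w ((w - z) *\<^sub>C A (?R z ?c))"
      have Acz: "(w - z) *\<^sub>C A (?R z ?c) \<in> H"
        using cz subH bop_app[OF lin(4)] by (simp add: csubspace_scaleC)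
      then have e: "?e \<in> H"
        using bop_app[OF Rb[OF w1]] by blast
      have "transfer_function \<tau> w m - transfer_function \<tau> z m = C (w *\<^sub>C ?R w ?b - z *\<^sub>C ?c)"
        using c cw subH by (simp add: tf bop_diff[OF subH lin(6)] bop_scaleC[OF lin(6)] csubspace_scaleC)
      also have "\<dots> = C ((w - z) *\<^sub>C ?R w ?c)"
        using resolvent_identities(2)[OF lin(1,4) bij[OF w1] bij[OF z] b] c
        by (simp add: bop_scaleC[OF Rb[OF w1]])
      finally have "transfer_function \<tau> w m - transfer_function \<tau> z m - (w - z) *\<^sub>C T m
          = (w - z) *\<^sub>C C (?R w ?c - ?R z ?c)"
        using cwz cz by (simp add: T_def bop_diff[OF subH lin(6)] bop_scaleC[OF lin(6)]
            scaleC.diff_right)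
      also have "?R w ?c - ?R z ?c = ?e"
        by (rule resolvent_identities(1)[OF lin(1,4) bij[OF w1] bij[OF z] c])
      finally have "norm (transfer_function \<tau> w m - transfer_function \<tau> z m - (w - z) *\<^sub>C T m)
          = cmod (w - z) * norm (C ?e)"
        by (simp add: norm_scaleC)
      also have "\<dots> \<le> cmod (w - z) * (2 / d * (cmod (w - z) * (1 / d * (1 / d * norm m))))"
      proof (rule mult_left_mono)
        have c_le: "norm ?c \<le> 1 / d * norm m"
          using R_le[OF z b] order_trans[OF _ mult_left_mono[OF B[OF m], of "1 / d"]] d
          by (simp add: d_def)
        have cz_le: "norm (?R z ?c) \<le> 1 / d * (1 / d * norm m)"
          using R_le[OF z c] order_trans[OF _ mult_left_mono[OF c_le, of "1 / d"]] d
          by (simp add: d_def)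
        have Acz_le: "norm ((w - z) *\<^sub>C A (?R z ?c)) \<le> cmod (w - z) * (1 / d * (1 / d * norm m))"
          unfolding norm_scaleC
          using order_trans[OF contraction_norm[OF A cz] cz_le] by (rule mult_left_mono) simp
        have "norm (C ?e) \<le> norm ?e"
          using C e by blast
        also have "\<dots> \<le> 1 / (1 - cmod w) * norm ((w - z) *\<^sub>C A (?R z ?c))"
          by (rule R_le[OF w1 Acz])
        also have "\<dots> \<le> 2 / d * norm ((w - z) *\<^sub>C A (?R z ?c))"
          using dw d by (intro mult_right_mono) (auto simp: field_simps)
        also have "\<dots> \<le> 2 / d * (cmod (w - z) * (1 / d * (1 / d * norm m)))"
          using Acz_le d by (intro mult_left_mono) auto
        finally show "norm (C ?e) \<le> 2 / d * (cmod (w - z) * (1 / d * (1 / d * norm m)))" .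
      qed simp
      also have "\<dots> = (2 / d ^ 3 * cmod (w - z)) * cmod (w - z) * norm m"
        by (simp add: power3_eq_cube mult_ac)
      finally show ?thesis .
    qed
    show "\<exists>T\<in>bop M N. \<forall>e>0. \<forall>\<^sub>F w in at z. \<forall>m\<in>M.
        norm (transfer_function \<tau> w m - transfer_function \<tau> z m - (w - z) *\<^sub>C T m)
          \<le> e * norm (w - z) * norm m"
    proof (intro bexI[OF _ Tb] allI impI)
      fix e :: real assume e: "e > 0"
      have "\<forall>\<^sub>F w in at z. cmod (w - z) < d / 2"
      proof (rule order_tendstoD(2))
        show "((\<lambda>w. cmod (w - z)) \<longlongrightarrow> cmod (z - z)) (at z)"
          by (intro tendsto_intros)
      qed (use d in simp)
      moreover have "\<forall>\<^sub>F w in at z. 2 / d ^ 3 * cmod (w - z) < e"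
      proof (rule order_tendstoD(2))
        show "((\<lambda>w. 2 / d ^ 3 * cmod (w - z)) \<longlongrightarrow> 2 / d ^ 3 * cmod (z - z)) (at z)"
          by (intro tendsto_intros)
      qed (use e in simp)
      ultimately show "\<forall>\<^sub>F w in at z. \<forall>m\<in>M.
        norm (transfer_function \<tau> w m - transfer_function \<tau> z m - (w - z) *\<^sub>C T m)
          \<le> e * norm (w - z) * norm m"
      proof eventually_elim
        case (elim w)
        show ?case
        proof
          fix m assume "m \<in> M"
          then have "norm (transfer_function \<tau> w m - transfer_function \<tau> z m - (w - z) *\<^sub>C T m)
            \<le> (2 / d ^ 3 * cmod (w - z)) * (cmod (w - z) * norm m)"
            using est[OF _ elim(1)] by (simp add: mult.assoc)
          also have "\<dots> \<le> e * (cmod (w - z) * norm m)"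
            using elim(2) by (intro mult_right_mono) auto
          finally show "norm (transfer_function \<tau> w m - transfer_function \<tau> z m - (w - z) *\<^sub>C T m)
            \<le> e * norm (w - z) * norm m"
            by (simp add: mult.assoc)
        qed
      qed
    qed
  qed
  then show ?thesis
    using contr by (auto simp: schur_class_def \<tau>)
qed

section \<open>Controllable subspaces and dual systems\<close>

lemma csubspace_hull: "csubspace (csubspace hull E)"
  by (rule hull_in) (auto simp: csubspace_def)

lemma hilbert_closed_cspan: "hilbert (closed_cspan E)"
  by (simp add: closed_cspan_def hilbert_closure csubspace_hull)

lemma closed_cspan_superset: "E \<subseteq> closed_cspan E"
  unfolding closed_cspan_def by (meson closure_subset hull_subset order_trans)

lemma closed_cspan_least: "E \<subseteq> W \<Longrightarrow> hilbert W \<Longrightarrow> closed_cspan E \<subseteq> W"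
  unfolding closed_cspan_def
  by (intro closure_minimal hull_minimal) (auto simp: hilbert_csubspace hilbert_closed)

lemma hilbert_controllable_subspace: "hilbert (controllable_subspace \<tau>)"
  by (simp add: controllable_subspace_def hilbert_closed_cspan)

text \<open>Together with the next two lemmas this characterizes the controllable subspace as the
  least closed subspace that contains the range of B and is invariant under A, so that systems can
  be compared without expanding powers of A.\<close>

lemma controllable_subspace_least:
  assumes "hilbert W" "\<And>m. m \<in> insp \<tau> \<Longrightarrow> opB \<tau> m \<in> W" "\<And>h. h \<in> W \<Longrightarrow> opA \<tau> h \<in> W"
  shows "controllable_subspace \<tau> \<subseteq> W"
  unfolding controllable_subspace_def
proof (rule closed_cspan_least[OF _ assms(1)])
  have "(opA \<tau> ^^ k) (opB \<tau> m) \<in> W" if "m \<in> insp \<tau>" for k m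
    by (induction k) (use that assms in auto)
  then show "{(opA \<tau> ^^ k) (opB \<tau> m) | k m. m \<in> insp \<tau>} \<subseteq> W"
    by auto
qed

lemma opB_mem_controllable_subspace: "m \<in> insp \<tau> \<Longrightarrow> opB \<tau> m \<in> controllable_subspace \<tau>"
  unfolding controllable_subspace_def
  by (rule subsetD[OF closed_cspan_superset], rule CollectI, rule exI[of _ 0]) auto

text \<open>The vectors that A sends into the controllable subspace form a subspace containing the
  generators A^k B m, hence their span; continuity of A adds the closure.\<close>

lemma opA_mem_controllable_subspace:
  assumes "linear_system \<tau>" and h: "h \<in> controllable_subspace \<tau>"
  shows "opA \<tau> h \<in> controllable_subspace \<tau>"
proof -
  let ?E = "{(opA \<tau> ^^ k) (opB \<tau> m) | k m. m \<in> insp \<tau>}" and ?W = "controllable_subspace \<tau>"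
  have lin: "hilbert (stsp \<tau>)" "opA \<tau> \<in> bop (stsp \<tau>) (stsp \<tau>)" "opB \<tau> \<in> bop (insp \<tau>) (stsp \<tau>)"
    using assms by (auto simp: linear_system_def)
  note W = hilbert_controllable_subspace[of \<tau>]
  have WH: "?W \<subseteq> stsp \<tau>"
    by (rule controllable_subspace_least) (use lin bop_app in auto)
  have hull: "csubspace hull ?E \<subseteq> {h \<in> stsp \<tau>. opA \<tau> h \<in> ?W}"
  proof (rule hull_minimal)
    have "(opA \<tau> ^^ k) (opB \<tau> m) \<in> ?W \<and> opA \<tau> ((opA \<tau> ^^ k) (opB \<tau> m)) \<in> ?W"
      if "m \<in> insp \<tau>" for k m
    proof -
      have "(opA \<tau> ^^ k) (opB \<tau> m) \<in> ?W" for k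
        unfolding controllable_subspace_def using that by (intro subsetD[OF closed_cspan_superset]) auto
      from this[of k] this[of "Suc k"] show ?thesis by simp
    qed
    then show "?E \<subseteq> {h \<in> stsp \<tau>. opA \<tau> h \<in> ?W}"
      using WH by auto
    show "csubspace {h \<in> stsp \<tau>. opA \<tau> h \<in> ?W}"
      using hilbert_csubspace[OF lin(1)] hilbert_csubspace[OF W] lin(2)
        bop_zero[OF hilbert_csubspace[OF lin(1)] lin(2)]
      unfolding csubspace_def[of "Collect _"]
      by (auto simp: bop_add bop_scaleC csubspace_intros)
  qed
  show ?thesis
  proof (rule bop_closure_into[where T = "opA \<tau>" and E = "csubspace hull ?E" and X = ?W])
    show "opA \<tau> \<in> bop ?W (stsp \<tau>)"
      using lin(2) WH by (rule bop_subset) simp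
    show "csubspace hull ?E \<subseteq> ?W" "?W \<subseteq> closure (csubspace hull ?E)"
      unfolding controllable_subspace_def closed_cspan_def by (auto intro: subsetD[OF closure_subset])
  qed (use hull W h in \<open>auto simp: hilbert_csubspace hilbert_closed\<close>)
qed

section \<open>Dual systems and adjoints of block operators\<close>

definition dual_system :: "('h::chilbert, 'm::chilbert, 'n::chilbert) system \<Rightarrow> ('h, 'n, 'm) system"
  where "dual_system \<tau> = System (adj (stsp \<tau>) (opA \<tau>)) (adj (stsp \<tau>) (opC \<tau>)) (adj (insp \<tau>) (opB \<tau>))
    (adj (insp \<tau>) (opD \<tau>)) (stsp \<tau>) (outsp \<tau>) (insp \<tau>)"

lemma observable_subspace_eq_dual: "observable_subspace \<tau> = controllable_subspace (dual_system \<tau>)"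
  by (simp add: observable_subspace_def controllable_subspace_def dual_system_def)

lemma linear_system_dual: "linear_system \<tau> \<Longrightarrow> linear_system (dual_system \<tau>)"
  by (auto simp: linear_system_def dual_system_def intro: adj_bop)

lemma block_op_bop:
  assumes "linear_system \<tau>"
  shows "block_op \<tau> \<in> bop (stsp \<tau> \<times> insp \<tau>) (stsp \<tau> \<times> outsp \<tau>)"
proof -
  obtain A B C D H M N where \<tau>: "\<tau> = System A B C D H M N"
    by (cases \<tau>)
  have lin: "hilbert H" "hilbert M" "hilbert N" "A \<in> bop H H" "B \<in> bop M H" "C \<in> bop H N"
    "D \<in> bop M N"
    using assms by (simp_all add: linear_system_def \<tau>)
  have fst: "fst \<in> bop (H \<times> M) H" and snd: "snd \<in> bop (H \<times> M) M"
    by (auto intro!: bopI[where K = 1] simp: scaleC_prod_def norm_fst_le norm_snd_le)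
  define P where "P p = A (fst p) + B (snd p)" for p
  define Q where "Q p = C (fst p) + D (snd p)" for p
  have P: "P \<in> bop (H \<times> M) H"
    unfolding P_def
    by (intro bop_plus bop_compose[OF lin(4) fst] bop_compose[OF lin(5) snd] hilbert_csubspace lin)
  have Q: "Q \<in> bop (H \<times> M) N"
    unfolding Q_def
    by (intro bop_plus bop_compose[OF lin(6) fst] bop_compose[OF lin(7) snd] hilbert_csubspace lin)
  obtain K L where K: "\<And>p. p \<in> H \<times> M \<Longrightarrow> norm (P p) \<le> K * norm p"
    and L: "\<And>p. p \<in> H \<times> M \<Longrightarrow> norm (Q p) \<le> L * norm p"
    using bop_bound[OF P] bop_bound[OF Q] by metis
  have "(\<lambda>p. (P p, Q p)) \<in> bop (H \<times> M) (H \<times> N)"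
  proof (rule bopI)
    fix p assume p: "p \<in> H \<times> M"
    have "norm (P p, Q p) \<le> norm (P p) + norm (Q p)"
      by (rule norm_Pair_le)
    then show "norm (P p, Q p) \<le> (K + L) * norm p"
      using K[OF p] L[OF p] by (simp add: distrib_right)
  next
    show "(P (c *\<^sub>C p), Q (c *\<^sub>C p)) = c *\<^sub>C (P p, Q p)" if "p \<in> H \<times> M" for c p
      using that by (simp add: bop_scaleC[OF P] bop_scaleC[OF Q] scaleC_prod_def[of c "(P p, Q p)"])
  qed (use bop_app[OF P] bop_app[OF Q] in \<open>auto simp: bop_add[OF P] bop_add[OF Q]\<close>)
  moreover have "(\<lambda>p. (P p, Q p)) = block_op \<tau>"
    by (auto simp: P_def Q_def block_op_def \<tau>)
  ultimately show ?thesis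
    by (simp add: \<tau>)
qed

text \<open>An equality of functions and not only on the carrier, so that it can rewrite the
  definition of co-isometric systems. It is checked block by block inside the inner product.\<close>

lemma adj_block_op:
  fixes \<tau> :: "('a::chilbert, 'b::chilbert, 'c::chilbert) system"
  assumes "linear_system \<tau>"
  shows "adj (stsp \<tau> \<times> insp \<tau>) (block_op \<tau>) = block_op (dual_system \<tau>)"
proof
  fix p :: "'a \<times> 'c"
  obtain h n where p: "p = (h, n)" by (cases p)
  obtain A B C D H M N where \<tau>: "\<tau> = System A B C D H M N"
    by (cases \<tau>)
  have lin: "hilbert H" "hilbert M" "hilbert N" "A \<in> bop H H" "B \<in> bop M H" "C \<in> bop H N"
    "D \<in> bop M N"
    using assms by (simp_all add: linear_system_def \<tau>)
  have "adj (H \<times> M) (block_op \<tau>) (h, n) = block_op (dual_system \<tau>) (h, n)"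
  proof (rule adj_eqI)
    show "csubspace (H \<times> M)"
      using lin by (simp add: csubspace_Times hilbert_csubspace)
    show "block_op (dual_system \<tau>) (h, n) \<in> H \<times> M"
      using lin by (auto simp: block_op_def dual_system_def \<tau> hilbert_csubspace
          intro!: csubspace_add adj_mem)
    fix x assume "x \<in> H \<times> M"
    then obtain g m where x: "x = (g, m)" "g \<in> H" "m \<in> M" by auto
    then show "cinner (block_op \<tau> x) (h, n) = cinner x (block_op (dual_system \<tau>) (h, n))"
      by (simp add: block_op_def dual_system_def \<tau> cinner_prod_def cinner_add_left cinner_add_right
          cinner_adj[OF lin(1,4)] cinner_adj[OF lin(1,6)] cinner_adj[OF lin(2,5)]
          cinner_adj[OF lin(2,7)])
  qed
  then show "adj (stsp \<tau> \<times> insp \<tau>) (block_op \<tau>) p = block_op (dual_system \<tau>) p"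
    by (simp add: p \<tau>)
qed

lemma coisometric_system_iff_dual:
  assumes "linear_system \<tau>"
  shows "coisometric_system \<tau> \<longleftrightarrow> isometric_system (dual_system \<tau>)"
  using assms block_op_bop[OF assms] linear_system_dual[OF assms]
  by (simp add: coisometric_system_def isometric_system_def coisometric_def adj_block_op)
    (simp add: dual_system_def)

section \<open>The Moebius transformation of a system\<close>

text \<open>The common setting of both parts; \<open>F\<close> and \<open>G\<close> are taken
  bounded because part (2) starts from a linear system. The state, input and output spaces of
  \<open>tau\<close> are whole types, while \<open>nu\<close> has the two defect spaces as input and
  output spaces.\<close>

locale moebius_colligation =
  fixes D :: "'m::chilbert \<Rightarrow> 'n::chilbert" and S :: "'h::chilbert \<Rightarrow> 'h"
    and F :: "'m \<Rightarrow> 'h" and G :: "'h \<Rightarrow> 'n"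
  assumes D: "contraction UNIV UNIV D" and S: "S \<in> bop UNIV UNIV"
    and F: "F \<in> bop (defect_space UNIV D) UNIV"
    and G: "G \<in> bop UNIV (defect_space UNIV (adj UNIV D))"
begin

abbreviation Ds where "Ds \<equiv> adj UNIV D"
abbreviation dD where "dD \<equiv> defect UNIV D"
abbreviation dDs where "dDs \<equiv> defect UNIV Ds"
abbreviation X where "X \<equiv> defect_space UNIV D"
abbreviation Y where "Y \<equiv> defect_space UNIV Ds"
abbreviation nu where "nu \<equiv> System S F G (\<lambda>_. 0) UNIV X Y"
abbreviation A where "A \<equiv> \<lambda>h. - F (Ds (G h)) + S h"
abbreviation tau where
  "tau \<equiv> System A (\<lambda>m. F (dD m)) (\<lambda>h. dDs (G h)) D UNIV UNIV UNIV"

lemmas hU = hilbert_UNIV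
lemmas subU = hilbert_csubspace[OF hilbert_UNIV]
lemmas Db = contraction_bop[OF D]

lemma Ds: "contraction UNIV UNIV Ds"
  by (rule contraction_adj[OF hU D])

lemmas Dsb = contraction_bop[OF Ds]

lemma adj_Ds: "adj UNIV Ds = D"
  using adj_adj[OF hU subU Db] by auto

lemmas dDsb = defect_bop[OF hU hU Ds]
lemmas hX = hilbert_defect_space[OF hU hU D]
lemmas hY = hilbert_defect_space[OF hU hU Ds]
lemmas subX = hilbert_csubspace[OF hX]
lemmas subY = hilbert_csubspace[OF hY]
lemmas dD_mem = defect_mem_space[OF hU hU D UNIV_I]
lemmas dDs_mem = defect_mem_space[OF hU hU Ds UNIV_I]

lemma range_dD_subset: "range dD \<subseteq> X"
  using dD_mem by blast

lemma X_subset_closure: "X \<subseteq> closure (range dD)"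
  by (simp add: defect_space_def)

lemma D_dD: "D (dD m) = dDs (D m)"
  using defect_intertwine[OF hU hU D] by simp

lemma Ds_dDs: "Ds (dDs n) = dD (Ds n)"
  using defect_intertwine[OF hU hU Ds] by (simp add: adj_Ds)

lemma X_approx:
  assumes "u \<in> X"
  obtains f where "(\<lambda>k. dD (f k)) \<longlonglongrightarrow> u"
proof -
  obtain g where g: "\<And>k. g k \<in> range dD" "g \<longlonglongrightarrow> u"
    using assms unfolding defect_space_def closure_sequential by blast
  define f where "f k = inv dD (g k)" for k
  have "dD (f k) = g k" for k
    unfolding f_def by (rule f_inv_into_f[OF g(1)])
  then show ?thesis
    using that[of f] g(2) by simp
qed

text \<open>By D* D_{D*} = D_D D* the range of D_{D*} goes into the range of D_D, and continuity
  extends this to the closures. This is what makes F (D* G h) meaningful, the domain of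
  \<open>F\<close> being the defect space of \<open>D\<close>.\<close>

lemma Ds_mem:
  assumes "y \<in> Y"
  shows "Ds y \<in> X"
proof (rule bop_closure_into[where T = Ds and X = Y and E = "range dDs" and Z = UNIV])
  show "Ds \<in> bop Y UNIV"
    by (rule bop_subset[OF Dsb]) simp_all
  show "Y \<subseteq> closure (range dDs)"
    by (simp add: defect_space_def)
  show "range dDs \<subseteq> Y"
    using dDs_mem by blast
  show "Ds n \<in> X" if "n \<in> range dDs" for n
    using that by (auto simp: Ds_dDs dD_mem)
qed (use assms hX hY subY in \<open>simp_all add: hilbert_closed\<close>)

lemma Gb: "G h \<in> Y"
  using bop_app[OF G] by simp

lemma F_Ds_G_bop: "(\<lambda>h. F (Ds (G h))) \<in> bop UNIV UNIV"
proof -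
  have "Ds \<in> bop Y X"
    by (rule bop_codomain[OF bop_subset[OF Dsb] Ds_mem]) auto
  then show ?thesis
    by (intro bop_compose[OF F] bop_compose[OF _ G])
qed

lemma A_bop: "A \<in> bop UNIV UNIV"
  by (intro bop_plus bop_uminus subU F_Ds_G_bop S)

lemma dD_bop_X: "dD \<in> bop UNIV X"
  by (rule defect_bop_space[OF hU hU D])

lemma linear_nu: "linear_system nu"
  using S F G hX hY by (simp add: linear_system_def bop_null subY hilbert_UNIV)

lemma linear_tau: "linear_system tau"
proof -
  have "(\<lambda>h. dDs (G h)) \<in> bop UNIV UNIV"
    by (rule bop_compose[OF bop_subset[OF dDsb] G]) auto
  then show ?thesis
    using A_bop Db bop_compose[OF F dD_bop_X] by (simp add: linear_system_def hilbert_UNIV)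
qed

text \<open>The operator \<open>(m, y) \<mapsto> (D m + D\<^bsub>D*\<^esub> y, D\<^bsub>D\<^esub> m - D* y)\<close> is unitary.\<close>

lemma norm_julia:
  "(norm (dD m - Ds y))\<^sup>2 + (norm (dDs y + D m))\<^sup>2 = (norm m)\<^sup>2 + (norm y)\<^sup>2"
proof -
  \<comment> \<open>The relation D D_D = D_{D*} D makes the mixed terms of the two squares equal up
    to sign, so they cancel; the other terms pair up by ||D_D m||^2 + ||D m||^2 = ||m||^2 and its
    analogue for \<open>y\<close>.\<close>
  have "cinner (D m) (dDs y) = cinner (dDs (D m)) y"
    using defect_selfadjoint[OF hU hU Ds, of "D m" y] by simp
  also have "\<dots> = cinner (dD m) (Ds y)"
    using cinner_adj[OF hU Db, of "dD m" y] by (simp add: D_dD)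
  finally have "inner (dDs y) (D m) = inner (dD m) (Ds y)"
    by (metis Re_cinner inner_commute)
  then show ?thesis
    using norm_defect[OF hU hU D, of m] norm_defect[OF hU hU Ds, of y]
    unfolding power2_norm_eq_inner by (simp add: inner_simps inner_commute)
qed

text \<open>\<open>tau\<close> arises from \<open>nu\<close> by feeding \<open>y = G h\<close> and \<open>m\<close> into that unitary operator.\<close>

lemma norm_balance:
  assumes "u = dD m - Ds (G h)"
  shows "(norm (block_op tau (h, m)))\<^sup>2 + (norm (h, u))\<^sup>2
    = (norm (block_op nu (h, u)))\<^sup>2 + (norm (h, m))\<^sup>2"
proof -
  have "F u = F (dD m) - F (Ds (G h))"
    unfolding assms by (rule bop_diff[OF subX F dD_mem Ds_mem[OF Gb]])
  then have tau: "block_op tau (h, m) = (S h + F u, dDs (G h) + D m)"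
    by (simp add: block_op_def)
  have nu: "block_op nu (h, u) = (S h + F u, G h)"
    by (simp add: block_op_def)
  show ?thesis
    using norm_julia[of m "G h", folded assms] unfolding tau nu norm_Pair_power2 by linarith
qed

section \<open>Passivity and isometry under the feedback loop\<close>

lemma feedback_mem: "dD m - Ds (G h) \<in> X"
  by (rule csubspace_diff[OF subX dD_mem Ds_mem[OF Gb]])

text \<open>For fixed \<open>h\<close> the vectors D_D m - D* G h are a translate of the dense range
  of D_D by an element of \<open>X\<close>, hence dense in \<open>X\<close>. Continuity of
  \<open>F\<close> carries the approximation through the block operator.\<close>

lemma X_approx_feedback:
  assumes "u \<in> X"
  obtains f where "(\<lambda>k. dD (f k) - Ds (G h)) \<longlonglongrightarrow> u"
    "(\<lambda>k. block_op nu (h, dD (f k) - Ds (G h))) \<longlonglongrightarrow> block_op nu (h, u)"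
proof -
  have "u + Ds (G h) \<in> X"
    using assms Ds_mem[OF Gb] subX by (simp add: csubspace_add)
  then obtain f where "(\<lambda>k. dD (f k)) \<longlonglongrightarrow> u + Ds (G h)"
    by (rule X_approx)
  from tendsto_diff[OF this tendsto_const[of "Ds (G h)"]]
  have lim: "(\<lambda>k. dD (f k) - Ds (G h)) \<longlonglongrightarrow> u"
    by simp
  have "(\<lambda>k. F (dD (f k) - Ds (G h))) \<longlonglongrightarrow> F u"
    by (rule continuous_on_tendsto_compose[OF bop_continuous_on[OF subX F] lim assms])
      (simp add: feedback_mem)
  then have "(\<lambda>k. block_op nu (h, dD (f k) - Ds (G h))) \<longlonglongrightarrow> block_op nu (h, u)"
    by (simp add: block_op_def tendsto_Pair tendsto_add)
  then show ?thesis
    using that lim by blast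
qed

text \<open>From \<open>nu\<close> to \<open>tau\<close> the balance is enough, since every (h, m)
  has a matching (h, u). Conversely the inequality for \<open>nu\<close> is first known at feedback
  vectors u only and extends to \<open>X\<close> by a limit.\<close>

lemma passive_iff: "passive_system tau \<longleftrightarrow> passive_system nu"
proof
  assume nu: "passive_system nu"
  have "norm (block_op tau (h, m)) \<le> norm (h, m)" for h m
  proof -
    let ?u = "dD m - Ds (G h)"
    have "norm (block_op nu (h, ?u)) \<le> norm (h, ?u)"
      using nu feedback_mem by (auto simp: passive_system_def contraction_def)
    then have "(norm (block_op nu (h, ?u)))\<^sup>2 \<le> (norm (h, ?u))\<^sup>2"
      by (simp add: power_mono)
    then have "(norm (block_op tau (h, m)))\<^sup>2 \<le> (norm (h, m))\<^sup>2"
      using norm_balance[OF refl, of h m] by linarith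
    then show ?thesis
      by (rule power2_le_imp_le) simp
  qed
  then show "passive_system tau"
    using block_op_bop[OF linear_tau] linear_tau by (simp add: passive_system_def contraction_def)
next
  assume tau: "passive_system tau"
  have "norm (block_op nu (h, u)) \<le> norm (h, u)" if u: "u \<in> X" for h u
  proof -
    obtain f where f: "(\<lambda>k. dD (f k) - Ds (G h)) \<longlonglongrightarrow> u"
      "(\<lambda>k. block_op nu (h, dD (f k) - Ds (G h))) \<longlonglongrightarrow> block_op nu (h, u)"
      by (rule X_approx_feedback[OF u, of h])
    have le: "norm (block_op nu (h, dD m - Ds (G h))) \<le> norm (h, dD m - Ds (G h))" for m
    proof -
      have "norm (block_op tau (h, m)) \<le> norm (h, m)"
        using tau by (auto simp: passive_system_def contraction_def)
      then have "(norm (block_op tau (h, m)))\<^sup>2 \<le> (norm (h, m))\<^sup>2"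
        by (simp add: power_mono)
      then have "(norm (block_op nu (h, dD m - Ds (G h))))\<^sup>2 \<le> (norm (h, dD m - Ds (G h)))\<^sup>2"
        using norm_balance[OF refl, of h m] by linarith
      then show ?thesis
        by (rule power2_le_imp_le) simp
    qed
    show ?thesis
      by (rule LIMSEQ_le[OF tendsto_norm[OF f(2)] tendsto_norm[OF tendsto_Pair[OF tendsto_const f(1)]]])
        (use le in auto)
  qed
  then show "passive_system nu"
    using block_op_bop[OF linear_nu] linear_nu by (auto simp: passive_system_def contraction_def)
qed

lemma isometric_iff: "isometric_system tau \<longleftrightarrow> isometric_system nu"
proof
  assume nu: "isometric_system nu"
  have "norm (block_op tau (h, m)) = norm (h, m)" for h m
  proof -
    let ?u = "dD m - Ds (G h)"
    have "norm (block_op nu (h, ?u)) = norm (h, ?u)"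
      using nu feedback_mem by (auto simp: isometric_system_def isometric_def)
    then have "(norm (block_op tau (h, m)))\<^sup>2 = (norm (h, m))\<^sup>2"
      using norm_balance[OF refl, of h m] by simp
    then show ?thesis
      by simp
  qed
  then show "isometric_system tau"
    using block_op_bop[OF linear_tau] linear_tau by (simp add: isometric_system_def isometric_def)
next
  assume tau: "isometric_system tau"
  have "norm (block_op nu (h, u)) = norm (h, u)" if u: "u \<in> X" for h u
  proof -
    obtain f where f: "(\<lambda>k. dD (f k) - Ds (G h)) \<longlonglongrightarrow> u"
      "(\<lambda>k. block_op nu (h, dD (f k) - Ds (G h))) \<longlonglongrightarrow> block_op nu (h, u)"
      by (rule X_approx_feedback[OF u, of h])
    have eq: "norm (block_op nu (h, dD m - Ds (G h))) = norm (h, dD m - Ds (G h))" for m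
    proof -
      have "norm (block_op tau (h, m)) = norm (h, m)"
        using tau by (auto simp: isometric_system_def isometric_def)
      then have "(norm (block_op nu (h, dD m - Ds (G h))))\<^sup>2 = (norm (h, dD m - Ds (G h)))\<^sup>2"
        using norm_balance[OF refl, of h m] by simp
      then show ?thesis
        by simp
    qed
    have "(\<lambda>k. norm (h, dD (f k) - Ds (G h))) \<longlonglongrightarrow> norm (block_op nu (h, u))"
      using tendsto_norm[OF f(2)] by (simp only: eq)
    moreover have "(\<lambda>k. norm (h, dD (f k) - Ds (G h))) \<longlonglongrightarrow> norm (h, u)"
      by (rule tendsto_norm[OF tendsto_Pair[OF tendsto_const f(1)]])
    ultimately show ?thesis
      by (rule LIMSEQ_unique)
  qed
  then show "isometric_system nu"
    using block_op_bop[OF linear_nu] linear_nu by (auto simp: isometric_system_def isometric_def)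
qed

lemma controllable_subspace_eq: "controllable_subspace tau = controllable_subspace nu"
proof
  show "controllable_subspace tau \<subseteq> controllable_subspace nu"
  proof (rule controllable_subspace_least[OF hilbert_controllable_subspace])
    let ?W = "controllable_subspace nu"
    have F_mem: "F u \<in> ?W" if "u \<in> X" for u
      using opB_mem_controllable_subspace[of u nu] that by simp
    then show "opB tau m \<in> ?W" for m
      by (simp add: dD_mem)
    fix h assume "h \<in> ?W"
    then have "S h \<in> ?W"
      using opA_mem_controllable_subspace[OF linear_nu] by simp
    then show "opA tau h \<in> ?W"
      using F_mem[OF Ds_mem[OF Gb]]
      by (simp add: csubspace_diff hilbert_csubspace hilbert_controllable_subspace)
  qed
next
  show "controllable_subspace nu \<subseteq> controllable_subspace tau"
  proof (rule controllable_subspace_least[OF hilbert_controllable_subspace])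
    let ?W = "controllable_subspace tau"
    have F_dD: "F (dD m) \<in> ?W" for m
      using opB_mem_controllable_subspace[of m tau] by simp
    \<comment> \<open>So far the subspace is known to contain only the vectors F D_D m. Density of
      the range of D_D in \<open>X\<close> and closedness of the subspace give F u for all u in
      \<open>X\<close>, in particular F D* G h.\<close>
    have F_mem: "F u \<in> ?W" if "u \<in> X" for u
    proof (rule bop_closure_into[OF subX F hilbert_closed[OF hilbert_controllable_subspace]
          range_dD_subset X_subset_closure hilbert_closed[OF hX] _ that])
      show "F x \<in> ?W" if "x \<in> range dD" for x
        using that F_dD by blast
    qed
    then show "opB nu u \<in> ?W" if "u \<in> insp nu" for u
      using that by simp
    fix h assume "h \<in> ?W"
    then have "A h \<in> ?W"
      using opA_mem_controllable_subspace[OF linear_tau] by simp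
    then have "A h + F (Ds (G h)) \<in> ?W"
      by (rule csubspace_add[OF hilbert_csubspace[OF hilbert_controllable_subspace] _
            F_mem[OF Ds_mem[OF Gb]]])
    then show "opA nu h \<in> ?W"
      by simp
  qed
qed

section \<open>Duality: co-isometric systems and observable subspaces\<close>

lemma moebius_colligation_dual: "moebius_colligation Ds (adj UNIV S) (adj UNIV G) (adj X F)"
proof
  show "contraction UNIV UNIV Ds"
    by (rule Ds)
  show "adj UNIV S \<in> bop UNIV UNIV" "adj UNIV G \<in> bop Y UNIV"
    by (rule adj_bop[OF hU S] adj_bop[OF hU G])+
  show "adj X F \<in> bop UNIV (defect_space UNIV (adj UNIV Ds))"
    unfolding adj_Ds by (rule adj_bop[OF hX F])
qed

lemma dual_nu:
  "dual_system nu = System (adj UNIV S) (adj UNIV G) (adj X F) (\<lambda>_. 0) UNIV Y X"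
proof -
  have "adj X (\<lambda>_. 0) = (\<lambda>_::'n. 0)"
    by (intro ext adj_eqI[OF subX]) (auto simp: csubspace_zero subX cinner.zero_left cinner.zero_right)
  then show ?thesis
    by (simp add: dual_system_def)
qed

text \<open>The result has the shape of \<open>tau\<close> for the data D*, S*, G*, F*, with the
  roles of F and G exchanged. Being an equation between systems of total functions, it lets the
  results on isometry and controllability be reused by rewriting alone.\<close>

lemma dual_tau:
  "dual_system tau = System (\<lambda>h. - adj UNIV G (D (adj X F h)) + adj UNIV S h)
    (\<lambda>n. adj UNIV G (dDs n)) (\<lambda>h. dD (adj X F h)) Ds UNIV UNIV UNIV"
proof -
  have "adj UNIV A = (\<lambda>h. - adj UNIV G (D (adj X F h)) + adj UNIV S h)"
  proof (intro ext adj_eqI[OF subU UNIV_I])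
    fix h x
    have "cinner (F (Ds (G x))) h = cinner (Ds (G x)) (adj X F h)"
      by (rule cinner_adj[OF hX F Ds_mem[OF Gb]])
    also have "\<dots> = cinner (G x) (D (adj X F h))"
      by (rule cinner_adj_left[OF hU Db UNIV_I])
    also have "\<dots> = cinner x (adj UNIV G (D (adj X F h)))"
      by (rule cinner_adj[OF hU G UNIV_I])
    finally show "cinner (A x) h = cinner x (- adj UNIV G (D (adj X F h)) + adj UNIV S h)"
      using cinner_adj[OF hU S UNIV_I, of x h]
      by (simp add: cinner.diff_left cinner.diff_right flip: diff_conv_add_uminus add: add.commute)
  qed
  moreover have "adj UNIV (\<lambda>h. dDs (G h)) = (\<lambda>n. adj UNIV G (dDs n))"
  proof (intro ext adj_eqI[OF subU UNIV_I])
    show "cinner (dDs (G x)) n = cinner x (adj UNIV G (dDs n))" for x n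
      using defect_selfadjoint[OF hU hU Ds, of "G x" n] cinner_adj[OF hU G UNIV_I, of x "dDs n"]
      by simp
  qed
  moreover have "adj UNIV (\<lambda>m. F (dD m)) = (\<lambda>h. dD (adj X F h))"
  proof (intro ext adj_eqI[OF subU UNIV_I])
    show "cinner (F (dD x)) h = cinner x (dD (adj X F h))" for x h
      using defect_selfadjoint[OF hU hU D, of x "adj X F h"] cinner_adj[OF hX F dD_mem, of x h]
      by simp
  qed
  ultimately show ?thesis
    by (simp add: dual_system_def)
qed

lemma coisometric_iff: "coisometric_system tau \<longleftrightarrow> coisometric_system nu"
proof -
  interpret dual: moebius_colligation Ds "adj UNIV S" "adj UNIV G" "adj X F"
    by (rule moebius_colligation_dual)
  show ?thesis
    using dual.isometric_iff
    unfolding coisometric_system_iff_dual[OF linear_nu] coisometric_system_iff_dual[OF linear_tau]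
      dual_nu dual_tau adj_Ds .
qed

lemma observable_subspace_eq: "observable_subspace tau = observable_subspace nu"
proof -
  interpret dual: moebius_colligation Ds "adj UNIV S" "adj UNIV G" "adj X F"
    by (rule moebius_colligation_dual)
  show ?thesis
    using dual.controllable_subspace_eq
    unfolding observable_subspace_eq_dual dual_nu dual_tau adj_Ds .
qed

section \<open>Transfer functions and the Moebius relation\<close>

lemma transfer_nu_mem: "transfer_function nu z u \<in> Y"
  using Gb by (simp add: transfer_function_resolvent csubspace_scaleC[OF subY])

lemma transfer_tau_zero: "transfer_function tau 0 = D"
  by (rule ext) (simp add: transfer_function_def scaleC.zero_left)

text \<open>With \<open>h = (I - zA)\<^sup>-\<^sup>1 F v\<close> and \<open>u = v - z D* G h\<close> one has \<open>(I - zS) h = F u\<close>, so the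
  value of the transfer function of \<open>nu\<close> at \<open>u\<close> is \<open>z G h\<close>.\<close>

definition feedback_solution :: "complex \<Rightarrow> 'm \<Rightarrow> 'm"
  where "feedback_solution z v = v - z *\<^sub>C Ds (G (resolvent UNIV A z (F v)))"

context
  fixes z :: complex
  assumes bijA: "bij (\<lambda>h. h - z *\<^sub>C A h)" and bijS: "bij (\<lambda>h. h - z *\<^sub>C S h)"
begin

lemma feedback_solution_mem: "v \<in> X \<Longrightarrow> feedback_solution z v \<in> X"
  unfolding feedback_solution_def
  by (intro csubspace_diff[OF subX] csubspace_scaleC[OF subX] Ds_mem Gb)

lemma transfer_nu_feedback_solution:
  assumes v: "v \<in> X"
  shows "transfer_function nu z (feedback_solution z v) = z *\<^sub>C G (resolvent UNIV A z (F v))"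
proof -
  let ?h = "resolvent UNIV A z (F v)"
  have "?h - z *\<^sub>C A ?h = F v"
    by (rule resolvent_right[OF bijA UNIV_I])
  moreover have "F (feedback_solution z v) = F v - z *\<^sub>C F (Ds (G ?h))"
    unfolding feedback_solution_def
    using v Ds_mem[OF Gb] by (simp add: bop_diff[OF subX F] bop_scaleC[OF F] csubspace_scaleC[OF subX])
  moreover have "?h - z *\<^sub>C S ?h = (?h - z *\<^sub>C A ?h) - z *\<^sub>C F (Ds (G ?h))"
    by (simp add: scaleC.diff_right)
  ultimately have "?h - z *\<^sub>C S ?h = F (feedback_solution z v)"
    by (simp only:)
  then have "resolvent UNIV S z (F (feedback_solution z v)) = ?h"
    by (rule resolvent_eqI[OF bijS UNIV_I])
  then show ?thesis
    by (simp add: transfer_function_resolvent)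
qed

lemma feedback_solution_solves:
  assumes v: "v \<in> X"
  shows "feedback_solution z v + Ds (transfer_function nu z (feedback_solution z v)) = v"
  unfolding transfer_nu_feedback_solution[OF v]
  by (simp add: feedback_solution_def bop_scaleC[OF Dsb UNIV_I])

text \<open>Let v be the argument of \<open>feedback_solution\<close>. The state g = (I - zS)^{-1} F
  u of \<open>nu\<close> also satisfies (I - zA) g = F v, so it is the very state from which
  \<open>feedback_solution\<close> recovers u.\<close>

lemma feedback_solution_unique:
  assumes u: "u \<in> X"
  shows "feedback_solution z (u + Ds (transfer_function nu z u)) = u"
proof -
  let ?g = "resolvent UNIV S z (F u)" and ?v = "u + Ds (transfer_function nu z u)"
  have tf: "transfer_function nu z u = z *\<^sub>C G ?g"
    by (simp add: transfer_function_resolvent)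
  have "F ?v = F u + z *\<^sub>C F (Ds (G ?g))"
    unfolding tf using u Ds_mem[OF Gb]
    by (simp add: bop_scaleC[OF Dsb UNIV_I] bop_add[OF F] bop_scaleC[OF F] csubspace_scaleC[OF subX])
  moreover have "?g - z *\<^sub>C S ?g = F u"
    by (rule resolvent_right[OF bijS UNIV_I])
  moreover have "?g - z *\<^sub>C A ?g = (?g - z *\<^sub>C S ?g) + z *\<^sub>C F (Ds (G ?g))"
    by (simp add: scaleC.diff_right)
  ultimately have "?g - z *\<^sub>C A ?g = F ?v"
    by (simp only:)
  then have "resolvent UNIV A z (F ?v) = ?g"
    by (rule resolvent_eqI[OF bijA UNIV_I])
  then show ?thesis
    by (simp add: feedback_solution_def tf bop_scaleC[OF Dsb UNIV_I])
qed

text \<open>\<open>feedback_solution z\<close> is an explicit two-sided inverse; this is the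
  invertibility that the definition of a Moebius parameter demands.\<close>

lemma bij_betw_moebius: "bij_betw (\<lambda>u. u + Ds (transfer_function nu z u)) X X"
proof (rule bij_betw_byWitness[where f' = "feedback_solution z"])
  show "(\<lambda>u. u + Ds (transfer_function nu z u)) ` X \<subseteq> X"
    by (intro image_subsetI csubspace_add[OF subX] Ds_mem transfer_nu_mem)
qed (use feedback_solution_unique feedback_solution_solves feedback_solution_mem in auto)

text \<open>For h = (I - zA)^{-1} F D_D m the value of the transfer function of \<open>nu\<close> at
  the feedback solution is z G h, and D_{D*} turns it into z C h with C = D_{D*} G.\<close>

lemma transfer_tau:
  "transfer_function tau z m = D m + dDs (transfer_function nu z (feedback_solution z (dD m)))"
  unfolding transfer_nu_feedback_solution[OF dD_mem]
  by (simp add: transfer_function_resolvent bop_scaleC[OF dDsb UNIV_I])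

end

text \<open>Passivity of both systems makes their state operators contractions, so I - zA and I - zS
  are bijective on the whole disk and the computation at a single frequency applies throughout
  it.\<close>

lemma is_mobius_parameter_transfer:
  assumes tau: "passive_system tau"
  shows "is_mobius_parameter UNIV UNIV (transfer_function tau) (transfer_function nu)"
proof -
  have nu: "passive_system nu"
    using tau passive_iff by simp
  have bij: "bij (\<lambda>h. h - z *\<^sub>C A h)" "bij (\<lambda>h. h - z *\<^sub>C S h)" if "cmod z < 1" for z
  proof -
    have A: "contraction UNIV UNIV A" and S: "contraction UNIV UNIV S"
      using passive_system_contraction(1)[OF tau] passive_system_contraction(1)[OF nu] by simp_all
    show "bij (\<lambda>h. h - z *\<^sub>C A h)" "bij (\<lambda>h. h - z *\<^sub>C S h)"
      by (rule resolvent_norm_bop(3)[OF hU A that] resolvent_norm_bop(3)[OF hU S that])+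
  qed
  have inv: "inv_into X (\<lambda>u. u + Ds (transfer_function nu z u)) (dD m) = feedback_solution z (dD m)"
    if "cmod z < 1" for z m
    by (rule inv_into_f_eq[OF bij_betw_imp_inj_on[OF bij_betw_moebius[OF bij[OF that]]]])
      (use feedback_solution_mem[OF bij[OF that] dD_mem]
        feedback_solution_solves[OF bij[OF that] dD_mem] in auto)
  show ?thesis
    unfolding is_mobius_parameter_def Let_def transfer_tau_zero
    using transfer_function_schur_class[OF tau] transfer_function_schur_class[OF nu]
      bij_betw_moebius[OF bij] transfer_tau[OF bij] by (simp add: inv)
qed

text \<open>A competing Moebius parameter agrees with the transfer function of \<open>nu\<close> on the image of
  \<open>range dD\<close> under \<open>feedback_solution z\<close>, which is dense because that map is continuous.\<close>

lemma mobius_parameter_unique: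
  assumes tau: "passive_system tau"
    and Z: "is_mobius_parameter UNIV UNIV (transfer_function tau) Z"
    and z: "cmod z < 1" and u: "u \<in> X"
  shows "Z z u = transfer_function nu z u"
proof -
  have nu: "passive_system nu"
    using tau passive_iff by simp
  have A: "contraction UNIV UNIV A" and S: "contraction UNIV UNIV S"
    using passive_system_contraction(1)[OF tau] passive_system_contraction(1)[OF nu] by simp_all
  have bijA: "bij (\<lambda>h. h - z *\<^sub>C A h)" and bijS: "bij (\<lambda>h. h - z *\<^sub>C S h)"
    by (rule resolvent_norm_bop(3)[OF hU A z] resolvent_norm_bop(3)[OF hU S z])+
  note bij = bijA bijS
  have Zb: "Z z \<in> bop X Y" and nub: "transfer_function nu z \<in> bop X Y"
    and bijZ: "bij_betw (\<lambda>u. u + Ds (Z z u)) X X"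
    and tfZ: "transfer_function tau z m
      = D m + dDs (Z z (inv_into X (\<lambda>u. u + Ds (Z z u)) (dD m)))" for m
    using Z transfer_function_schur_class[OF nu] z
    unfolding is_mobius_parameter_def Let_def transfer_tau_zero schur_class_def
    by (simp_all add: contraction_bop)
  let ?\<Phi> = "feedback_solution z"
  have agree: "Z z (?\<Phi> (dD m)) = transfer_function nu z (?\<Phi> (dD m))" for m
  proof -
    define w where "w = inv_into X (\<lambda>u. u + Ds (Z z u)) (dD m)"
    have "dD m \<in> (\<lambda>u. u + Ds (Z z u)) ` X"
      using bijZ dD_mem by (simp add: bij_betw_def)
    then have w: "w \<in> X" "w + Ds (Z z w) = dD m"
      unfolding w_def by (rule inv_into_into, rule f_inv_into_f)
    \<comment> \<open>D_{D*} annihilates \<open>?y\<close>, which lies in its defect space; there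
      D_{D*} is injective.\<close>
    let ?y = "Z z w - transfer_function nu z (?\<Phi> (dD m))"
    have "dDs (Z z w) = dDs (transfer_function nu z (?\<Phi> (dD m)))"
      using tfZ[of m] transfer_tau[OF bij, of m] by (simp add: w_def)
    then have "dDs ?y = 0"
      by (simp add: bop_diff[OF subU dDsb])
    moreover have "?y \<in> Y"
      using bop_app[OF Zb w(1)] transfer_nu_mem by (rule csubspace_diff[OF subY])
    ultimately have eq: "Z z w = transfer_function nu z (?\<Phi> (dD m))"
      using defect_eq_zero_iff[OF hU hU Ds] by auto
    have "w = ?\<Phi> (dD m)"
      using w(2) feedback_solution_solves[OF bij dD_mem, of m] by (metis eq add_right_cancel)
    then show ?thesis
      using eq by simp
  qed
  \<comment> \<open>The feedback map sends this \<open>v\<close> to \<open>u\<close>, so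
    approximating \<open>v\<close> by vectors D_D (f k) approximates \<open>u\<close> by points at
    which both functions are known to agree.\<close>
  define v where "v = u + Ds (transfer_function nu z u)"
  have v: "v \<in> X" and \<Phi>v: "?\<Phi> v = u"
    unfolding v_def using feedback_solution_unique[OF bij u]
      csubspace_add[OF subX u Ds_mem[OF transfer_nu_mem]] by auto
  obtain f where f: "(\<lambda>k. dD (f k)) \<longlonglongrightarrow> v"
    using v by (rule X_approx)
  have "(\<lambda>x. resolvent UNIV A z (F x)) \<in> bop X UNIV"
    by (rule bop_compose[OF resolvent_norm_bop(2)[OF hU A z] F])
  from bop_compose[OF Dsb bop_subset[OF bop_compose[OF G this] subset_refl subset_UNIV]]
  have "?\<Phi> \<in> bop X UNIV"
    unfolding feedback_solution_def
    by (intro bop_minus_fun[OF subU] bop_id bop_scaleC_fun[OF subU]) auto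
  then have "continuous_on X ?\<Phi>"
    by (rule bop_continuous_on[OF subX])
  then have \<Phi>f: "(\<lambda>k. ?\<Phi> (dD (f k))) \<longlonglongrightarrow> u"
    using continuous_on_tendsto_compose[OF _ f v] dD_mem by (fastforce simp: \<Phi>v)
  have mem: "\<forall>\<^sub>F k in sequentially. ?\<Phi> (dD (f k)) \<in> X"
    using feedback_solution_mem[OF bij dD_mem] by simp
  have "(\<lambda>k. Z z (?\<Phi> (dD (f k)))) \<longlonglongrightarrow> Z z u"
    by (rule continuous_on_tendsto_compose[OF bop_continuous_on[OF subX Zb] \<Phi>f u mem])
  moreover have "(\<lambda>k. transfer_function nu z (?\<Phi> (dD (f k)))) \<longlonglongrightarrow> transfer_function nu z u"
    by (rule continuous_on_tendsto_compose[OF bop_continuous_on[OF subX nub] \<Phi>f u mem])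
  ultimately show ?thesis
    unfolding agree by (rule LIMSEQ_unique)
qed

text \<open>Near 0 both I - zA and I - zS are invertible by boundedness of A and S. There I + D*
  Z(z) agrees on \<open>X\<close> with the corresponding map for \<open>nu\<close>, so the inverse
  in the Moebius relation for \<Theta> is given by \<open>feedback_solution\<close> as well.\<close>

lemma transfer_tau_near_zero:
  assumes Z: "is_mobius_parameter UNIV UNIV \<Theta> Z" and \<Theta>: "\<Theta> 0 = D"
    and eq: "\<forall>\<^sub>F z in nhds 0. \<forall>u\<in>X. transfer_function nu z u = Z z u"
  shows "\<forall>\<^sub>F z in nhds 0. \<forall>m. transfer_function tau z m = \<Theta> z m"
proof -
  have "\<forall>\<^sub>F z in nhds 0. z \<in> ball (0::complex) 1"
    by (rule eventually_nhds_in_open) auto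
  with eq eventually_bij_betw_id_minus_scaleC[OF hU A_bop] eventually_bij_betw_id_minus_scaleC[OF hU S]
  show ?thesis
  proof eventually_elim
    case (elim z)
    note bij = elim(2,3)
    have bijZ: "bij_betw (\<lambda>u. u + Ds (Z z u)) X X"
      and tfZ: "\<Theta> z m = D m + dDs (Z z (inv_into X (\<lambda>u. u + Ds (Z z u)) (dD m)))" for m
      using Z elim(4) by (auto simp: is_mobius_parameter_def Let_def \<Theta>)
    show ?case
    proof
      fix m
      let ?u = "feedback_solution z (dD m)"
      have u: "?u \<in> X"
        by (rule feedback_solution_mem[OF bij dD_mem])
      have "inv_into X (\<lambda>u. u + Ds (Z z u)) (dD m) = ?u"
        by (rule inv_into_f_eq[OF bij_betw_imp_inj_on[OF bijZ] u])
          (use elim(1) u feedback_solution_solves[OF bij dD_mem, of m] in simp)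
      then show "transfer_function tau z m = \<Theta> z m"
        unfolding transfer_tau[OF bij] tfZ using elim(1) u by simp
    qed
  qed
qed

end

text \<open>Phrased for any two systems with equal subspaces, since part (1) passes from
  \<open>tau\<close> to \<open>nu\<close> and part (2) from \<open>nu\<close> to
  \<open>tau\<close>.\<close>

lemma system_properties_transfer:
  assumes "stsp \<sigma> = stsp \<tau>" "controllable_subspace \<sigma> = controllable_subspace \<tau>"
    and "observable_subspace \<sigma> = observable_subspace \<tau>"
  shows "controllable \<tau> \<Longrightarrow> controllable \<sigma>" "observable \<tau> \<Longrightarrow> observable \<sigma>"
    and "simple_system \<tau> \<Longrightarrow> simple_system \<sigma>" "minimal_system \<tau> \<Longrightarrow> minimal_system \<sigma>"
  using assms
  by (simp_all add: controllable_def observable_def simple_system_def minimal_system_def)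

text \<open>That the transfer function of the reduced system is the Moebius parameter takes two
  clauses: it is one, and every other one agrees with it on the disk and on the defect space,
  outside of which values carry no meaning.\<close>

theorem theorem4p4:
  assumes "separable_space (euclidean :: 'h::chilbert topology)"
    and "separable_space (euclidean :: 'm::chilbert topology)"
    and "separable_space (euclidean :: 'n::chilbert topology)"
  shows
    "(\<forall>(A :: 'h \<Rightarrow> 'h) (B :: 'm \<Rightarrow> 'h) (C :: 'h \<Rightarrow> 'n) (D :: 'm \<Rightarrow> 'n) F G L.
       let Ds = adj UNIV D; DD = defect_space UNIV D; DDs = defect_space UNIV Ds;
           Fs = adj DD F;
           \<tau> = System A B C D UNIV UNIV UNIV;
           \<nu> = System (\<lambda>h. defect UNIV Fs (L (defect UNIV G h))) F G (\<lambda>_. 0) UNIV DD DDs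
       in passive_system \<tau> \<longrightarrow>
          contraction DD UNIV F \<longrightarrow>
          contraction UNIV DDs G \<longrightarrow>
          contraction (defect_space UNIV G) (defect_space UNIV Fs) L \<longrightarrow>
          (\<forall>h. A h = - F (Ds (G h)) + defect UNIV Fs (L (defect UNIV G h))) \<longrightarrow>
          (\<forall>m. B m = F (defect UNIV D m)) \<longrightarrow>
          (\<forall>h. C h = defect UNIV Ds (G h)) \<longrightarrow>
            passive_system \<nu> \<and>
            is_mobius_parameter UNIV UNIV (transfer_function \<tau>) (transfer_function \<nu>) \<and>
            (\<forall>Z. is_mobius_parameter UNIV UNIV (transfer_function \<tau>) Z \<longrightarrow>
              (\<forall>z\<in>ball 0 1. \<forall>u\<in>DD. Z z u = transfer_function \<nu> z u)) \<and>
            (isometric_system \<tau> \<longrightarrow> isometric_system \<nu>) \<and>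
            (coisometric_system \<tau> \<longrightarrow> coisometric_system \<nu>) \<and>
            controllable_subspace \<nu> = controllable_subspace \<tau> \<and>
            observable_subspace \<nu> = observable_subspace \<tau> \<and>
            (controllable \<tau> \<longrightarrow> controllable \<nu>) \<and>
            (observable \<tau> \<longrightarrow> observable \<nu>) \<and>
            (simple_system \<tau> \<longrightarrow> simple_system \<nu>) \<and>
            (minimal_system \<tau> \<longrightarrow> minimal_system \<nu>)) \<and>
     (\<forall>(\<Theta> :: complex \<Rightarrow> 'm \<Rightarrow> 'n) Z (S :: 'h \<Rightarrow> 'h) F G.
       let \<Theta>0 = \<Theta> 0; \<Theta>0s = adj UNIV \<Theta>0;
           X = defect_space UNIV \<Theta>0; Y = defect_space UNIV \<Theta>0s;
           \<nu>' = System S F G (\<lambda>_. 0) UNIV X Y;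
           \<tau>' = System (\<lambda>h. - F (\<Theta>0s (G h)) + S h) (\<lambda>m. F (defect UNIV \<Theta>0 m))
                  (\<lambda>h. defect UNIV \<Theta>0s (G h)) \<Theta>0 UNIV UNIV UNIV
       in \<Theta> \<in> schur_class UNIV UNIV \<longrightarrow>
          (\<exists>z\<in>ball 0 1. \<exists>w\<in>ball 0 1. \<Theta> z \<noteq> \<Theta> w) \<longrightarrow>
          is_mobius_parameter UNIV UNIV \<Theta> Z \<longrightarrow>
          linear_system \<nu>' \<longrightarrow>
          (\<forall>\<^sub>F z in nhds 0. \<forall>u\<in>X. transfer_function \<nu>' z u = Z z u) \<longrightarrow>
            linear_system \<tau>' \<and>
            (\<forall>\<^sub>F z in nhds 0. \<forall>m. transfer_function \<tau>' z m = \<Theta> z m) \<and>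
            controllable_subspace \<tau>' = controllable_subspace \<nu>' \<and>
            observable_subspace \<tau>' = observable_subspace \<nu>' \<and>
            (controllable \<nu>' \<longrightarrow> controllable \<tau>') \<and>
            (observable \<nu>' \<longrightarrow> observable \<tau>') \<and>
            (simple_system \<nu>' \<longrightarrow> simple_system \<tau>') \<and>
            (minimal_system \<nu>' \<longrightarrow> minimal_system \<tau>') \<and>
            (passive_system \<nu>' \<longrightarrow> passive_system \<tau>') \<and>
            (isometric_system \<nu>' \<longrightarrow> isometric_system \<tau>') \<and>
            (coisometric_system \<nu>' \<longrightarrow> coisometric_system \<tau>'))"
  unfolding Let_def
proof (rule conjI, goal_cases)
  case 1
  show ?case
  proof (intro allI impI)
    fix A :: "'h \<Rightarrow> 'h" and B :: "'m \<Rightarrow> 'h" and C :: "'h \<Rightarrow> 'n" and D :: "'m \<Rightarrow> 'n"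
      and F :: "'m \<Rightarrow> 'h" and G :: "'h \<Rightarrow> 'n" and L :: "'h \<Rightarrow> 'h"
    let ?Ds = "adj UNIV D"
    let ?X = "defect_space UNIV D" and ?Y = "defect_space UNIV ?Ds"
    let ?Fs = "adj ?X F"
    let ?S = "\<lambda>h. defect UNIV ?Fs (L (defect UNIV G h))"
    assume tau: "passive_system (System A B C D UNIV UNIV UNIV)"
      and F: "contraction ?X UNIV F" and G: "contraction UNIV ?Y G"
      and L: "contraction (defect_space UNIV G) (defect_space UNIV ?Fs) L"
      and A: "\<forall>h. A h = - F (?Ds (G h)) + ?S h"
      and B: "\<forall>m. B m = F (defect UNIV D m)"
      and C: "\<forall>h. C h = defect UNIV ?Ds (G h)"
    have D: "contraction UNIV UNIV D"
      using passive_system_contraction(4)[OF tau] by simp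
    have X: "hilbert ?X"
      by (rule hilbert_defect_space[OF hilbert_UNIV hilbert_UNIV D])
    have Y: "hilbert ?Y"
      by (rule hilbert_defect_space[OF hilbert_UNIV hilbert_UNIV contraction_adj[OF hilbert_UNIV D]])
    have Fs: "contraction UNIV ?X ?Fs"
      by (rule contraction_adj[OF X F])
    \<comment> \<open>D_G maps into the defect space of \<open>G\<close>, which is the domain of
      \<open>L\<close>.\<close>
    have S: "?S \<in> bop UNIV UNIV"
      by (rule bop_compose[OF bop_subset[OF defect_bop[OF hilbert_UNIV X Fs] subset_UNIV subset_UNIV]
            bop_compose[OF contraction_bop[OF L] defect_bop_space[OF hilbert_UNIV Y G]]])
    interpret moebius_colligation D ?S F G
      using D S contraction_bop[OF F] contraction_bop[OF G] by unfold_locales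
    \<comment> \<open>The blocks are functions on whole types, so the pointwise equations make the
      two systems equal and all results on \<open>tau\<close> carry over by rewriting.\<close>
    have \<tau>: "System A B C D UNIV UNIV UNIV = tau"
      using A B C by auto
    note tau' = tau[unfolded \<tau>]
    note props = system_properties_transfer[of nu tau, OF _ controllable_subspace_eq[symmetric]
        observable_subspace_eq[symmetric], simplified system.sel, OF refl]
    show "passive_system nu \<and>
      is_mobius_parameter UNIV UNIV (transfer_function (System A B C D UNIV UNIV UNIV)) (transfer_function nu) \<and>
      (\<forall>Z. is_mobius_parameter UNIV UNIV (transfer_function (System A B C D UNIV UNIV UNIV)) Z \<longrightarrow>
        (\<forall>z\<in>ball 0 1. \<forall>u\<in>X. Z z u = transfer_function nu z u)) \<and>
      (isometric_system (System A B C D UNIV UNIV UNIV) \<longrightarrow> isometric_system nu) \<and>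
      (coisometric_system (System A B C D UNIV UNIV UNIV) \<longrightarrow> coisometric_system nu) \<and>
      controllable_subspace nu = controllable_subspace (System A B C D UNIV UNIV UNIV) \<and>
      observable_subspace nu = observable_subspace (System A B C D UNIV UNIV UNIV) \<and>
      (controllable (System A B C D UNIV UNIV UNIV) \<longrightarrow> controllable nu) \<and>
      (observable (System A B C D UNIV UNIV UNIV) \<longrightarrow> observable nu) \<and>
      (simple_system (System A B C D UNIV UNIV UNIV) \<longrightarrow> simple_system nu) \<and>
      (minimal_system (System A B C D UNIV UNIV UNIV) \<longrightarrow> minimal_system nu)"
      unfolding \<tau>
    proof (intro conjI impI allI ballI)
      show "passive_system nu"
        using passive_iff tau' by blast
      show "is_mobius_parameter UNIV UNIV (transfer_function tau) (transfer_function nu)"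
        by (rule is_mobius_parameter_transfer[OF tau'])
      show "Z z u = transfer_function nu z u"
        if "is_mobius_parameter UNIV UNIV (transfer_function tau) Z" "z \<in> ball 0 1" "u \<in> X" for Z z u
        by (rule mobius_parameter_unique[OF tau' that(1) _ that(3)]) (use that(2) in simp)
      show "isometric_system nu" if "isometric_system tau"
        using isometric_iff that by blast
      show "coisometric_system nu" if "coisometric_system tau"
        using coisometric_iff that by blast
    qed (rule controllable_subspace_eq[symmetric] observable_subspace_eq[symmetric] | erule props)+
  qed
next
  case 2
  show ?case
  proof (intro allI impI)
    fix \<Theta> :: "complex \<Rightarrow> 'm \<Rightarrow> 'n" and Z and S :: "'h \<Rightarrow> 'h"
      and F :: "'m \<Rightarrow> 'h" and G :: "'h \<Rightarrow> 'n"
    let ?\<nu> = "System S F G (\<lambda>_. 0) UNIV (defect_space UNIV (\<Theta> 0)) (defect_space UNIV (adj UNIV (\<Theta> 0)))"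
    assume \<Theta>: "\<Theta> \<in> schur_class UNIV UNIV" and Z: "is_mobius_parameter UNIV UNIV \<Theta> Z"
      and lin: "linear_system ?\<nu>"
      and eq: "\<forall>\<^sub>F z in nhds 0. \<forall>u\<in>defect_space UNIV (\<Theta> 0). transfer_function ?\<nu> z u = Z z u"
    interpret moebius_colligation "\<Theta> 0" S F G
      using \<Theta> lin by unfold_locales (simp_all add: schur_class_def linear_system_def)
    note props = system_properties_transfer[of tau nu, OF _ controllable_subspace_eq
        observable_subspace_eq, simplified system.sel, OF refl]
    show "linear_system tau \<and>
      (\<forall>\<^sub>F z in nhds 0. \<forall>m. transfer_function tau z m = \<Theta> z m) \<and>
      controllable_subspace tau = controllable_subspace nu \<and>
      observable_subspace tau = observable_subspace nu \<and>
      (controllable nu \<longrightarrow> controllable tau) \<and>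
      (observable nu \<longrightarrow> observable tau) \<and>
      (simple_system nu \<longrightarrow> simple_system tau) \<and>
      (minimal_system nu \<longrightarrow> minimal_system tau) \<and>
      (passive_system nu \<longrightarrow> passive_system tau) \<and>
      (isometric_system nu \<longrightarrow> isometric_system tau) \<and>
      (coisometric_system nu \<longrightarrow> coisometric_system tau)"
      using linear_tau transfer_tau_near_zero[OF Z refl eq] controllable_subspace_eq
        observable_subspace_eq props passive_iff isometric_iff coisometric_iff by blast
  qed
qed

end
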